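(* Let $\mathcal{A}$ be a partial combinatory algebra, $\mathcal{A}_\#\subseteq\mathcal{A}$ a sub-pca, and $\kappa$ a strongly inaccessible (in particular uncountable) cardinal exceeding the cardinality of $\mathcal{A}$. Let $\mathcal{S}$ be the class of all maps $f:Y\to X$ in $\mathbf{Asm}(\mathcal{A},\mathcal{A}_\#)$ such that $\mathrm{card}(f^{-1}(x))<\kappa$ for all $x\in|X|$ (fibres of the underlying function). Then $\mathcal{S}$ is a class of small maps in $\mathbf{Asm}(\mathcal{A},\mathcal{A}_\#)$, i.e. it satisfies (A0)–(A9).
   Context: A sub-pca $\mathcal{A}_\#$ of a pca $\mathcal{A}$ (partial application written by juxtaposition) is a subset closed under application (when defined) such that there are $k,s\in\mathcal{A}_\#$ with, for all $x,y,z\in\mathcal{A}$: $kxy=x$, $sxy$ is always defined, and $sxyz\simeq xz(yz)$. For $A,B\subseteq\mathcal{A}$ put $A\to B=\{a\in\mathcal{A}\mid ax\text{ is defined and }ax\in B\text{ for all }x\in A\}$. Let $\Sigma(\mathcal{A},\mathcal{A}_\#)$ be the set of pairs $A=(A_p,A_a)$ with $A_p\subseteq\mathcal{A}$, $A_a\subseteq\mathcal{A}_\#$ and $A_a\subseteq A_p$. For $A,B\in\Sigma(\mathcal{A},\mathcal{A}_\#)$ put $$A\to B=\bigl(A_p\to B_p,\ \mathcal{A}_\#\cap(A_p\to B_p)\cap(A_a\to B_a)\bigr).$$ For a set $I$ and $\phi,\psi:I\to\Sigma(\mathcal{A},\mathcal{A}_\#)$ write $\phi\vdash_I\psi$ iff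 $\bigcap_{i\in I}(\phi(i)\to\psi(i))_a\neq\emptyset$. The category $\mathbf{Asm}(\mathcal{A},\mathcal{A}_\#)$: objects are pairs $X=(|X|,E_X)$ with $|X|$ a set and $E_X:|X|\to\Sigma(\mathcal{A},\mathcal{A}_\#)$ such that $E_X(x)_p\neq\emptyset$ for all $x\in|X|$; an arrow $X\to Y$ is a function $f:|X|\to|Y|$ with $E_X\vdash_{|X|}E_Y\circ f$. It is a locally cartesian closed Heyting category with stable disjoint finite sums and a natural numbers object $N$. A cover is a regular epimorphism. A commutative square is a quasipullback if the mediating arrow into the pullback is a cover. A class of maps $\mathcal{S}$ is a class of small maps if it satisfies: (A0) Pullback stability: any pullback of a map in $\mathcal{S}$ is in $\mathcal{S}$. (A1) Descent: if $g$ is the pullback of $f$ along a cover and $g\in\mathcal{S}$, then $f\in\mathcal{S}$. (A2) Sums: if $f,g\in\mathcal{S}$ then $f+g\in\mathcal{S}$. (A3) Finiteness: $0\to1$, $1\to1$ and $1+1\to1$ are in $\mathcal{S}$. (A4) Composition: $\mathcal{S}$ is closed under composition. (A5) Quotient: if $f\circ e\in\mathcal{S}$ and $e$ is a cover then $f\in\mathcal{S}$. (A6) Collection: for any cover $p:Y\to X$ and $f:X\to A$ in $\mathcal{S}$ there are a cover $h:B\to A$, a map $g:Z\to B$ in $\mathcal{S}$ and a map $q:Z\to Y$ such that the square $f\circ(p\circ q)=h\circ g$ is a quasipullback. (A7) Representability: there is a map $\pi:E\to U$ in $\mathcal{S}$ such that for every $f:Y\to X$ in $\mathcal{S}$ there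 are a map $f':Y'\to X'$ which is a pullback of $\pi$ along some $X'\to U$, and covers $Y'\to Y$, $X'\to X$ forming with $f',f$ a quasipullback square. (A8) Infinity: $N\to1$ is in $\mathcal{S}$. (A9) Separation: all monomorphisms are in $\mathcal{S}$. *)

theory Defs
  imports "HOL-Library.FuncSet"
begin

unbundle cardinal_syntax

section \<open>Sets and cardinals\<close>

text \<open>
  The sets underlying assemblies are the elements of a universe \<open>'v\<close>, with
  \<open>elts v\<close> the set of members of \<open>v\<close>, satisfying the axioms of ZFC.  Separation and replacement
  are second-order (arbitrary HOL sets and functions); choice is inherited from HOL.  Pairing
  and the empty set follow from the axioms listed.
\<close>

definition zfc_universe :: "('v \<Rightarrow> 'v set) \<Rightarrow> bool" where
  "zfc_universe elts \<longleftrightarrow>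
     inj elts \<and>
     wf {(x, y). x \<in> elts y} \<and>
     (\<forall>v S. S \<subseteq> elts v \<longrightarrow> (\<exists>w. elts w = S)) \<and>
     (\<forall>v. \<exists>w. elts w = (\<Union>x\<in>elts v. elts x)) \<and>
     (\<forall>v. \<exists>w. elts w = {u. elts u \<subseteq> elts v}) \<and>
     (\<forall>v f. \<exists>w. elts w = f ` elts v) \<and>
     (\<exists>v. infinite (elts v))"

text \<open>Every cardinal below \<open>\<kappa>\<close> is the cardinality of some \<open>S :: 'k set\<close>.\<close>

definition strongly_inaccessible :: "'k rel \<Rightarrow> bool" where
  "strongly_inaccessible \<kappa> \<longleftrightarrow>
     Card_order \<kappa> \<and> natLeq <o \<kappa> \<and> regularCard \<kappa> \<and>
     (\<forall>S :: 'k set. |S| <o \<kappa> \<longrightarrow> |Pow S| <o \<kappa>)"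

section \<open>Partial combinatory algebras\<close>

text \<open>
  Partial application is \<open>'a \<Rightarrow> 'a \<Rightarrow> 'a option\<close>; \<open>pap\<close> extends it strictly to possibly
  undefined terms, so that equality of options is Kleene equality.
\<close>

definition pap :: "('a \<Rightarrow> 'a \<Rightarrow> 'a option) \<Rightarrow> 'a option \<Rightarrow> 'a option \<Rightarrow> 'a option" where
  "pap app t u = Option.bind t (\<lambda>a. Option.bind u (app a))"

definition sub_pca :: "('a \<Rightarrow> 'a \<Rightarrow> 'a option) \<Rightarrow> 'a set \<Rightarrow> bool" where
  "sub_pca app A\<^sub>s \<longleftrightarrow>
     (\<forall>x\<in>A\<^sub>s. \<forall>y\<in>A\<^sub>s. \<forall>z. app x y = Some z \<longrightarrow> z \<in> A\<^sub>s) \<and>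
     (\<exists>k\<in>A\<^sub>s. \<exists>s\<in>A\<^sub>s. \<forall>x y z.
        pap app (app k x) (Some y) = Some x \<and>
        pap app (app s x) (Some y) \<noteq> None \<and>
        pap app (pap app (app s x) (Some y)) (Some z) = pap app (app x z) (app y z))"

definition pca :: "('a \<Rightarrow> 'a \<Rightarrow> 'a option) \<Rightarrow> bool" where
  "pca app \<longleftrightarrow> sub_pca app UNIV"

definition pimp :: "('a \<Rightarrow> 'a \<Rightarrow> 'a option) \<Rightarrow> 'a set \<Rightarrow> 'a set \<Rightarrow> 'a set" where
  "pimp app A B = {a. \<forall>x\<in>A. \<exists>y\<in>B. app a x = Some y}"

text \<open>In a pair \<open>(A\<^sub>p, A\<^sub>a)\<close> the components are accessed by \<open>fst\<close> and \<open>snd\<close>.\<close>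

definition Sigma_pca :: "'a set \<Rightarrow> ('a set \<times> 'a set) set" where
  "Sigma_pca A\<^sub>s = {(P, Q). Q \<subseteq> A\<^sub>s \<and> Q \<subseteq> P}"

definition sigma_imp ::
  "('a \<Rightarrow> 'a \<Rightarrow> 'a option) \<Rightarrow> 'a set \<Rightarrow> 'a set \<times> 'a set \<Rightarrow> 'a set \<times> 'a set \<Rightarrow> 'a set \<times> 'a set" where
  "sigma_imp app A\<^sub>s A B =
     (pimp app (fst A) (fst B),
      A\<^sub>s \<inter> pimp app (fst A) (fst B) \<inter> pimp app (snd A) (snd B))"

definition entails ::
  "('a \<Rightarrow> 'a \<Rightarrow> 'a option) \<Rightarrow> 'a set \<Rightarrow> 'i set \<Rightarrow>
   ('i \<Rightarrow> 'a set \<times> 'a set) \<Rightarrow> ('i \<Rightarrow> 'a set \<times> 'a set) \<Rightarrow> bool" where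
  "entails app A\<^sub>s I \<phi> \<psi> \<longleftrightarrow> (\<Inter>i\<in>I. snd (sigma_imp app A\<^sub>s (\<phi> i) (\<psi> i))) \<noteq> {}"

section \<open>Categorical notions\<close>

record ('o, 'm) cat =
  Obj :: "'o set"
  Arr :: "'m set"
  Dom :: "'m \<Rightarrow> 'o"
  Cod :: "'m \<Rightarrow> 'o"
  Ident :: "'o \<Rightarrow> 'm"
  Comp :: "'m \<Rightarrow> 'm \<Rightarrow> 'm" (infixr "\<cdot>\<index>" 70)

definition hom :: "('o, 'm) cat \<Rightarrow> 'm \<Rightarrow> 'o \<Rightarrow> 'o \<Rightarrow> bool" where
  "hom C f X Y \<longleftrightarrow> f \<in> Arr C \<and> Dom C f = X \<and> Cod C f = Y"

definition terminal :: "('o, 'm) cat \<Rightarrow> 'o \<Rightarrow> bool" where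
  "terminal C T \<longleftrightarrow> T \<in> Obj C \<and> (\<forall>X\<in>Obj C. \<exists>!f. hom C f X T)"

definition initial :: "('o, 'm) cat \<Rightarrow> 'o \<Rightarrow> bool" where
  "initial C Z \<longleftrightarrow> Z \<in> Obj C \<and> (\<forall>X\<in>Obj C. \<exists>!f. hom C f Z X)"

definition monic :: "('o, 'm) cat \<Rightarrow> 'm \<Rightarrow> bool" where
  "monic C f \<longleftrightarrow> f \<in> Arr C \<and>
     (\<forall>W u v. hom C u W (Dom C f) \<and> hom C v W (Dom C f) \<and> f \<cdot>\<^bsub>C\<^esub> u = f \<cdot>\<^bsub>C\<^esub> v \<longrightarrow> u = v)"

definition coequalizer :: "('o, 'm) cat \<Rightarrow> 'm \<Rightarrow> 'm \<Rightarrow> 'm \<Rightarrow> bool" where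
  "coequalizer C e u v \<longleftrightarrow> e \<in> Arr C \<and>
     (\<exists>R. hom C u R (Dom C e) \<and> hom C v R (Dom C e)) \<and>
     e \<cdot>\<^bsub>C\<^esub> u = e \<cdot>\<^bsub>C\<^esub> v \<and>
     (\<forall>Z h. hom C h (Dom C e) Z \<and> h \<cdot>\<^bsub>C\<^esub> u = h \<cdot>\<^bsub>C\<^esub> v \<longrightarrow>
        (\<exists>!k. hom C k (Cod C e) Z \<and> k \<cdot>\<^bsub>C\<^esub> e = h))"

definition cover :: "('o, 'm) cat \<Rightarrow> 'm \<Rightarrow> bool" where
  "cover C e \<longleftrightarrow> (\<exists>u v. coequalizer C e u v)"

text \<open>The square \<open>f \<cdot> p = g \<cdot> q\<close>; the same argument order is used for pullbacks below.\<close>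

definition commutes :: "('o, 'm) cat \<Rightarrow> 'm \<Rightarrow> 'm \<Rightarrow> 'm \<Rightarrow> 'm \<Rightarrow> bool" where
  "commutes C p q f g \<longleftrightarrow>
     (\<exists>P X Y A. hom C p P X \<and> hom C q P Y \<and> hom C f X A \<and> hom C g Y A) \<and>
     f \<cdot>\<^bsub>C\<^esub> p = g \<cdot>\<^bsub>C\<^esub> q"

definition pullback :: "('o, 'm) cat \<Rightarrow> 'm \<Rightarrow> 'm \<Rightarrow> 'm \<Rightarrow> 'm \<Rightarrow> bool" where
  "pullback C p q f g \<longleftrightarrow> commutes C p q f g \<and>
     (\<forall>p' q'. commutes C p' q' f g \<longrightarrow>
        (\<exists>!m. hom C m (Dom C p') (Dom C p) \<and> p \<cdot>\<^bsub>C\<^esub> m = p' \<and> q \<cdot>\<^bsub>C\<^esub> m = q'))"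

definition quasi_pullback :: "('o, 'm) cat \<Rightarrow> 'm \<Rightarrow> 'm \<Rightarrow> 'm \<Rightarrow> 'm \<Rightarrow> bool" where
  "quasi_pullback C p q f g \<longleftrightarrow> commutes C p q f g \<and>
     (\<exists>p\<^sub>0 q\<^sub>0 m. pullback C p\<^sub>0 q\<^sub>0 f g \<and> hom C m (Dom C p) (Dom C p\<^sub>0) \<and>
        p\<^sub>0 \<cdot>\<^bsub>C\<^esub> m = p \<and> q\<^sub>0 \<cdot>\<^bsub>C\<^esub> m = q \<and> cover C m)"

definition coproduct :: "('o, 'm) cat \<Rightarrow> 'o \<Rightarrow> 'm \<Rightarrow> 'm \<Rightarrow> bool" where
  "coproduct C S i j \<longleftrightarrow> hom C i (Dom C i) S \<and> hom C j (Dom C j) S \<and>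
     (\<forall>Z h k. hom C h (Dom C i) Z \<and> hom C k (Dom C j) Z \<longrightarrow>
        (\<exists>!m. hom C m S Z \<and> m \<cdot>\<^bsub>C\<^esub> i = h \<and> m \<cdot>\<^bsub>C\<^esub> j = k))"

text \<open>\<open>h\<close> is the map \<open>f + g\<close> with respect to some choice of the two coproducts.\<close>

definition sum_map :: "('o, 'm) cat \<Rightarrow> 'm \<Rightarrow> 'm \<Rightarrow> 'm \<Rightarrow> bool" where
  "sum_map C f g h \<longleftrightarrow> f \<in> Arr C \<and> g \<in> Arr C \<and> h \<in> Arr C \<and>
     (\<exists>i j i' j'. coproduct C (Dom C h) i j \<and> coproduct C (Cod C h) i' j' \<and>
        Dom C i = Dom C f \<and> Dom C j = Dom C g \<and> Dom C i' = Cod C f \<and> Dom C j' = Cod C g \<and>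
        h \<cdot>\<^bsub>C\<^esub> i = i' \<cdot>\<^bsub>C\<^esub> f \<and> h \<cdot>\<^bsub>C\<^esub> j = j' \<cdot>\<^bsub>C\<^esub> g)"

definition natural_numbers_object :: "('o, 'm) cat \<Rightarrow> 'o \<Rightarrow> 'o \<Rightarrow> bool" where
  "natural_numbers_object C T N \<longleftrightarrow> terminal C T \<and>
     (\<exists>z s. hom C z T N \<and> hom C s N N \<and>
        (\<forall>X a t. hom C a T X \<and> hom C t X X \<longrightarrow>
           (\<exists>!u. hom C u N X \<and> u \<cdot>\<^bsub>C\<^esub> z = a \<and> u \<cdot>\<^bsub>C\<^esub> s = t \<cdot>\<^bsub>C\<^esub> u)))"

section \<open>Classes of small maps\<close>

text \<open>
  In (A2), (A3) and (A8) the objects \<open>X + Y\<close>, \<open>0\<close>, \<open>1\<close>, \<open>N\<close> are unique up to isomorphism only.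
  The axioms are stated with an existential choice of them, so that they are not vacuous when
  such objects are missing.  The choice is immaterial: by (A0) the class is closed under
  isomorphism of arrows, as such an isomorphism is a pullback square.
\<close>

definition A0_pullback_stability :: "('o, 'm) cat \<Rightarrow> 'm set \<Rightarrow> bool" where
  "A0_pullback_stability C S \<longleftrightarrow> (\<forall>p g f h. pullback C p g f h \<and> f \<in> S \<longrightarrow> g \<in> S)"

definition A1_descent :: "('o, 'm) cat \<Rightarrow> 'm set \<Rightarrow> bool" where
  "A1_descent C S \<longleftrightarrow> (\<forall>p g f e. pullback C p g f e \<and> cover C e \<and> g \<in> S \<longrightarrow> f \<in> S)"

definition A2_sums :: "('o, 'm) cat \<Rightarrow> 'm set \<Rightarrow> bool" where
  "A2_sums C S \<longleftrightarrow> (\<forall>f\<in>S. \<forall>g\<in>S. \<exists>h\<in>S. sum_map C f g h)"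

definition A3_finiteness :: "('o, 'm) cat \<Rightarrow> 'm set \<Rightarrow> bool" where
  "A3_finiteness C S \<longleftrightarrow>
     (\<exists>Z T. initial C Z \<and> terminal C T \<and> (\<exists>f\<in>S. hom C f Z T)) \<and>
     (\<exists>T. terminal C T \<and> (\<exists>f\<in>S. hom C f T T)) \<and>
     (\<exists>T P i j. terminal C T \<and> coproduct C P i j \<and> Dom C i = T \<and> Dom C j = T \<and>
        (\<exists>f\<in>S. hom C f P T))"

definition A4_composition :: "('o, 'm) cat \<Rightarrow> 'm set \<Rightarrow> bool" where
  "A4_composition C S \<longleftrightarrow> (\<forall>f\<in>S. \<forall>g\<in>S. Cod C f = Dom C g \<longrightarrow> g \<cdot>\<^bsub>C\<^esub> f \<in> S)"

definition A5_quotient :: "('o, 'm) cat \<Rightarrow> 'm set \<Rightarrow> bool" where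
  "A5_quotient C S \<longleftrightarrow>
     (\<forall>f e. f \<in> Arr C \<and> cover C e \<and> Cod C e = Dom C f \<and> f \<cdot>\<^bsub>C\<^esub> e \<in> S \<longrightarrow> f \<in> S)"

definition A6_collection :: "('o, 'm) cat \<Rightarrow> 'm set \<Rightarrow> bool" where
  "A6_collection C S \<longleftrightarrow>
     (\<forall>Y X A p f. cover C p \<and> hom C p Y X \<and> f \<in> S \<and> hom C f X A \<longrightarrow>
        (\<exists>B Z h g q. cover C h \<and> hom C h B A \<and> g \<in> S \<and> hom C g Z B \<and> hom C q Z Y \<and>
           quasi_pullback C (p \<cdot>\<^bsub>C\<^esub> q) g f h))"

definition A7_representability :: "('o, 'm) cat \<Rightarrow> 'm set \<Rightarrow> bool" where
  "A7_representability C S \<longleftrightarrow>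
     (\<exists>\<pi>\<in>S. \<forall>f\<in>S. \<exists>f' r u y x. pullback C r f' \<pi> u \<and> cover C y \<and> cover C x \<and>
        quasi_pullback C y f' f x)"

definition A8_infinity :: "('o, 'm) cat \<Rightarrow> 'm set \<Rightarrow> bool" where
  "A8_infinity C S \<longleftrightarrow> (\<exists>T N. natural_numbers_object C T N \<and> (\<exists>f\<in>S. hom C f N T))"

definition A9_separation :: "('o, 'm) cat \<Rightarrow> 'm set \<Rightarrow> bool" where
  "A9_separation C S \<longleftrightarrow> (\<forall>f. monic C f \<longrightarrow> f \<in> S)"

definition class_of_small_maps :: "('o, 'm) cat \<Rightarrow> 'm set \<Rightarrow> bool" where
  "class_of_small_maps C S \<longleftrightarrow> S \<subseteq> Arr C \<and>
     A0_pullback_stability C S \<and> A1_descent C S \<and> A2_sums C S \<and> A3_finiteness C S \<and>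
     A4_composition C S \<and> A5_quotient C S \<and> A6_collection C S \<and> A7_representability C S \<and>
     A8_infinity C S \<and> A9_separation C S"

section \<open>Assemblies\<close>

text \<open>
  The functions \<open>exist\<close> and \<open>fn\<close> are extensional (undefined outside the carrier), so that HOL
  equality of objects and arrows is the intended one.
\<close>

datatype ('v, 'a) asm = Asm_obj (carr: 'v) (exist: "'v \<Rightarrow> 'a set \<times> 'a set")

datatype ('v, 'a) asm_map = Asm_map (src: "('v, 'a) asm") (trg: "('v, 'a) asm") (fn: "'v \<Rightarrow> 'v")

definition assemblies :: "('v \<Rightarrow> 'v set) \<Rightarrow> 'a set \<Rightarrow> ('v, 'a) asm set" where
  "assemblies elts A\<^sub>s =
     {X. exist X \<in> elts (carr X) \<rightarrow>\<^sub>E Sigma_pca A\<^sub>s \<and> (\<forall>x\<in>elts (carr X). fst (exist X x) \<noteq> {})}"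

definition asm_maps ::
  "('v \<Rightarrow> 'v set) \<Rightarrow> ('a \<Rightarrow> 'a \<Rightarrow> 'a option) \<Rightarrow> 'a set \<Rightarrow> ('v, 'a) asm_map set" where
  "asm_maps elts app A\<^sub>s =
     {f. src f \<in> assemblies elts A\<^sub>s \<and> trg f \<in> assemblies elts A\<^sub>s \<and>
         fn f \<in> elts (carr (src f)) \<rightarrow>\<^sub>E elts (carr (trg f)) \<and>
         entails app A\<^sub>s (elts (carr (src f))) (exist (src f)) (exist (trg f) \<circ> fn f)}"

definition Asm ::
  "('v \<Rightarrow> 'v set) \<Rightarrow> ('a \<Rightarrow> 'a \<Rightarrow> 'a option) \<Rightarrow> 'a set \<Rightarrow> (('v, 'a) asm, ('v, 'a) asm_map) cat" where
  "Asm elts app A\<^sub>s =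
     \<lparr> Obj = assemblies elts A\<^sub>s,
       Arr = asm_maps elts app A\<^sub>s,
       Dom = src,
       Cod = trg,
       Ident = (\<lambda>X. Asm_map X X (\<lambda>x\<in>elts (carr X). x)),
       Comp = (\<lambda>g f. Asm_map (src f) (trg g) (compose (elts (carr (src f))) (fn g) (fn f))) \<rparr>"

definition fibre :: "('v \<Rightarrow> 'v set) \<Rightarrow> ('v, 'a) asm_map \<Rightarrow> 'v \<Rightarrow> 'v set" where
  "fibre elts f x = {y \<in> elts (carr (src f)). fn f y = x}"

definition small_maps ::
  "('v \<Rightarrow> 'v set) \<Rightarrow> ('a \<Rightarrow> 'a \<Rightarrow> 'a option) \<Rightarrow> 'a set \<Rightarrow> 'k rel \<Rightarrow> ('v, 'a) asm_map set" where
  "small_maps elts app A\<^sub>s \<kappa> =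
     {f \<in> asm_maps elts app A\<^sub>s. \<forall>x\<in>elts (carr (trg f)). |fibre elts f x| <o \<kappa>}"

end

theory Submission
  imports Defs
begin

text \<open>
  A map of assemblies is a cover iff it is surjective and some element of \<open>A\<^sub>s\<close> sends every
  realizer of \<open>y\<close> to a realizer of some point in the fibre over \<open>y\<close>; and a pullback square is a
  pullback of the underlying sets.  The axioms about fibres therefore reduce to the regularity of
  \<open>\<kappa>\<close>.  Collection holds over the given base: pairs of a point of \<open>X\<close> and one of its realizers
  form an assembly that covers \<open>X\<close> with fibres no larger than the pca, and on which a choice of
  preimages under a cover \<open>Y \<rightarrow> X\<close> is realized.  For representability, the object of codes
  of families of size below \<open>\<kappa>\<close> is given trivial realizers; then every small map is a pullback of
  the universal family on the nose.
\<close>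

section \<open>Programming with combinators\<close>

text \<open>One realizer has to serve all points at once, lie in \<open>A\<^sub>s\<close> and act
  correctly on both components. This is what obstructs Collection: choosing one preimage of each
  point under a cover gives a function that nothing need realize, because the realizer of the cover
  may send two realizers of the same point to realizers of different preimages. Once the realizer is
  part of the point, the preimage may be chosen depending on it. In Representability the codes of
  fibres rest on arbitrary injections into a set of size \<kappa>, so the classifying function has
  no reason to be computable; trivial realizers on the object of codes make it a map anyway. Nothing
  is lost, since the realizers of a fibre are stored inside its code and come back as realizers on
  the universal family.\<close>

definition trk :: "('a \<Rightarrow> 'a \<Rightarrow> 'a option) \<Rightarrow> 'a \<Rightarrow> 'a set \<times> 'a set \<Rightarrow> 'a set \<times> 'a set \<Rightarrow> bool" where
  "trk app r P Q \<longleftrightarrow> r \<in> pimp app (fst P) (fst Q) \<inter> pimp app (snd P) (snd Q)"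

lemma trkI:
  assumes "\<And>a. a \<in> fst P \<Longrightarrow> \<exists>b\<in>fst Q. app r a = Some b"
    and "\<And>a. a \<in> snd P \<Longrightarrow> \<exists>b\<in>snd Q. app r a = Some b"
  shows "trk app r P Q"
  using assms by (auto simp: trk_def pimp_def)

lemma trkD:
  assumes "trk app r P Q"
  shows "a \<in> fst P \<Longrightarrow> \<exists>b\<in>fst Q. app r a = Some b"
    and "a \<in> snd P \<Longrightarrow> \<exists>b\<in>snd Q. app r a = Some b"
  using assms by (auto simp: trk_def pimp_def)

lemma pap_Some [simp]: "pap app (Some x) (Some y) = app x y"
  by (simp add: pap_def)

locale combinatory =
  fixes app :: "'a \<Rightarrow> 'a \<Rightarrow> 'a option" and A\<^sub>s :: "'a set" and k s :: 'a
  assumes app_closed: "x \<in> A\<^sub>s \<Longrightarrow> y \<in> A\<^sub>s \<Longrightarrow> app x y = Some z \<Longrightarrow> z \<in> A\<^sub>s"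
    and k_mem: "k \<in> A\<^sub>s" and s_mem: "s \<in> A\<^sub>s"
    and k_law: "pap app (app k x) (Some y) = Some x"
    and s_total: "pap app (app s x) (Some y) \<noteq> None"
    and s_law: "pap app (pap app (app s x) (Some y)) (Some z) = pap app (app x z) (app y z)"
begin

text \<open>The applications \<open>k x\<close>, \<open>s x\<close> and \<open>s x y\<close> are
  always defined, so naming their values turns the combinator laws into unconditional rewrite
  rules.\<close>

definition k1 :: "'a \<Rightarrow> 'a" where "k1 x = the (app k x)"
definition s1 :: "'a \<Rightarrow> 'a" where "s1 x = the (app s x)"
definition s2 :: "'a \<Rightarrow> 'a \<Rightarrow> 'a" where "s2 x y = the (app (s1 x) y)"
definition cI :: 'a where "cI = s2 k k"

lemma app_k [simp]: "app k x = Some (k1 x)"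
  using k_law[of x x] by (cases "app k x") (auto simp: k1_def pap_def)

lemma app_k1 [simp]: "app (k1 x) y = Some x"
  using k_law[of x y] by simp

lemma app_s [simp]: "app s x = Some (s1 x)"
  using s_total[of x x] by (cases "app s x") (auto simp: s1_def pap_def)

lemma app_s1 [simp]: "app (s1 x) y = Some (s2 x y)"
  using s_total[of x y] by (simp add: s2_def)

lemma app_s2 [simp]: "app (s2 x y) z = pap app (app x z) (app y z)"
  using s_law[of x y z] by simp

lemma app_cI [simp]: "app cI x = Some x"
  by (simp add: cI_def)

lemma k1_mem [simp]: "x \<in> A\<^sub>s \<Longrightarrow> k1 x \<in> A\<^sub>s"
  using app_closed k_mem app_k by blast

lemma s1_mem [simp]: "x \<in> A\<^sub>s \<Longrightarrow> s1 x \<in> A\<^sub>s"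
  using app_closed s_mem app_s by blast

lemma s2_mem [simp]: "x \<in> A\<^sub>s \<Longrightarrow> y \<in> A\<^sub>s \<Longrightarrow> s2 x y \<in> A\<^sub>s"
  using app_closed s1_mem app_s1 by blast

lemma cI_mem [simp]: "cI \<in> A\<^sub>s"
  by (simp add: cI_def k_mem)

text \<open>Stands in for abstraction over one variable: \<open>computable_pap\<close> is the case
  of \<open>s\<close> and \<open>computable_const\<close> that of \<open>k\<close>, so every
  applicative term in the variable with constants in \<open>A\<^sub>s\<close> is represented by an
  element of \<open>A\<^sub>s\<close>. Partial terms are included, with Kleene equality.\<close>

definition computable :: "('a \<Rightarrow> 'a option) \<Rightarrow> bool" where
  "computable F \<longleftrightarrow> (\<exists>c\<in>A\<^sub>s. \<forall>x. app c x = F x)"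

lemma computable_app: "c \<in> A\<^sub>s \<Longrightarrow> computable (app c)"
  by (auto simp: computable_def)

lemma computable_id: "computable Some"
  using app_cI cI_mem computable_def by blast

lemma computable_const: "a \<in> A\<^sub>s \<Longrightarrow> computable (\<lambda>x. Some a)"
  using app_k1 k1_mem computable_def by blast

lemma computable_pap:
  assumes "computable F" "computable G"
  shows "computable (\<lambda>x. pap app (F x) (G x))"
proof -
  obtain f g where "f \<in> A\<^sub>s" "g \<in> A\<^sub>s" "\<forall>x. app f x = F x" "\<forall>x. app g x = G x"
    using assms by (auto simp: computable_def)
  then show ?thesis
    by (auto simp: computable_def intro!: bexI[of _ "s2 f g"])
qed

lemmas computable_intros = computable_pap computable_const computable_id

text \<open>The Church pair: it sends x to x a b, so that the projections are application to the
  selectors \<open>k\<close> and \<open>ki\<close>.\<close>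

definition pr :: "'a \<Rightarrow> 'a \<Rightarrow> 'a" where "pr a b = s2 (s2 cI (k1 a)) (k1 b)"
definition ki :: 'a where "ki = k1 cI"

lemma ki_mem [simp]: "ki \<in> A\<^sub>s"
  by (simp add: ki_def)

lemma pr_mem [simp]: "a \<in> A\<^sub>s \<Longrightarrow> b \<in> A\<^sub>s \<Longrightarrow> pr a b \<in> A\<^sub>s"
  by (simp add: pr_def)

lemma app_pr_k [simp]: "app (pr a b) k = Some a"
  by (simp add: pr_def)

lemma app_pr_ki [simp]: "app (pr a b) ki = Some b"
  by (simp add: pr_def ki_def)

lemma computable_pr: "a \<in> A\<^sub>s \<Longrightarrow> computable (\<lambda>b. Some (pr a b))"
  using computable_pap[OF computable_const[of "s1 (s2 cI (k1 a))"] computable_app[OF k_mem]]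
  by (simp add: pr_def)

lemma trk_id: "trk app cI P P"
  by (simp add: trk_def pimp_def)

text \<open>The element \<open>c\<close> is chosen before \<open>P\<close>, \<open>Q\<close> and
  \<open>R\<close>, because an arrow needs a single realizer for all points of its domain. The same
  order of quantifiers is kept in the lemmas on pairs and tags.\<close>

lemma trk_comp:
  assumes "r \<in> A\<^sub>s" "q \<in> A\<^sub>s"
  shows "\<exists>c\<in>A\<^sub>s. \<forall>P Q R. trk app r P Q \<longrightarrow> trk app q Q R \<longrightarrow> trk app c P R"
proof -
  have "computable (\<lambda>x. pap app (Some q) (app r x))"
    using assms by (intro computable_intros computable_app)
  then obtain c where c: "c \<in> A\<^sub>s" "\<And>x. app c x = pap app (Some q) (app r x)"
    by (auto simp: computable_def)
  have "trk app c P R" if "trk app r P Q" "trk app q Q R" for P Q R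
  proof (rule trkI)
    show "\<exists>b\<in>fst R. app c a = Some b" if "a \<in> fst P" for a
      using trkD(1)[OF \<open>trk app r P Q\<close> that] trkD(1)[OF \<open>trk app q Q R\<close>] by (auto simp: c(2))
    show "\<exists>b\<in>snd R. app c a = Some b" if "a \<in> snd P" for a
      using trkD(2)[OF \<open>trk app r P Q\<close> that] trkD(2)[OF \<open>trk app q Q R\<close>] by (auto simp: c(2))
  qed
  then show ?thesis using c(1) by blast
qed

section \<open>Conjunction, tagging and case distinction on pairs of realizer sets\<close>

definition both :: "'a set \<times> 'a set \<Rightarrow> 'a set \<times> 'a set \<Rightarrow> 'a set \<times> 'a set" where
  "both P Q = ((\<lambda>(a, b). pr a b) ` (fst P \<times> fst Q), (\<lambda>(a, b). pr a b) ` (snd P \<times> snd Q))"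

lemma both_mem: "P \<in> Sigma_pca A\<^sub>s \<Longrightarrow> Q \<in> Sigma_pca A\<^sub>s \<Longrightarrow> both P Q \<in> Sigma_pca A\<^sub>s"
  by (cases P; cases Q) (auto simp: Sigma_pca_def both_def subset_iff intro!: image_eqI)

lemma fst_both_nonempty: "fst P \<noteq> {} \<Longrightarrow> fst Q \<noteq> {} \<Longrightarrow> fst (both P Q) \<noteq> {}"
  by (auto simp: both_def)

lemma trk_fst: "\<exists>c\<in>A\<^sub>s. \<forall>P Q. trk app c (both P Q) P"
proof -
  have "computable (\<lambda>x. pap app (Some x) (Some k))"
    by (intro computable_intros k_mem)
  then obtain c where c: "c \<in> A\<^sub>s" "\<And>x. app c x = app x k"
    by (auto simp: computable_def)
  have "trk app c (both P Q) P" for P Q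
    by (intro trkI) (auto simp: both_def c(2))
  then show ?thesis using c(1) by blast
qed

lemma trk_snd: "\<exists>c\<in>A\<^sub>s. \<forall>P Q. trk app c (both P Q) Q"
proof -
  have "computable (\<lambda>x. pap app (Some x) (Some ki))"
    by (intro computable_intros ki_mem)
  then obtain c where c: "c \<in> A\<^sub>s" "\<And>x. app c x = app x ki"
    by (auto simp: computable_def)
  have "trk app c (both P Q) Q" for P Q
    by (intro trkI) (auto simp: both_def c(2))
  then show ?thesis using c(1) by blast
qed

definition tag :: "'a \<Rightarrow> 'a set \<times> 'a set \<Rightarrow> 'a set \<times> 'a set" where
  "tag t P = (pr t ` fst P, pr t ` snd P)"

lemma tag_mem: "t \<in> A\<^sub>s \<Longrightarrow> P \<in> Sigma_pca A\<^sub>s \<Longrightarrow> tag t P \<in> Sigma_pca A\<^sub>s"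
  by (auto simp: Sigma_pca_def tag_def)

lemma fst_tag_nonempty: "fst P \<noteq> {} \<Longrightarrow> fst (tag t P) \<noteq> {}"
  by (simp add: tag_def)

lemma trk_tag:
  assumes "t \<in> A\<^sub>s"
  shows "\<exists>c\<in>A\<^sub>s. \<forall>P. trk app c P (tag t P)"
proof -
  obtain c where c: "c \<in> A\<^sub>s" "\<And>x. app c x = Some (pr t x)"
    using computable_pr[OF assms] by (auto simp: computable_def)
  have "trk app c P (tag t P)" for P
    by (intro trkI) (auto simp: tag_def c(2))
  then show ?thesis using c(1) by blast
qed

text \<open>The tag is itself a selector: applied to \<open>r\<close> and \<open>q\<close> it
  returns the program for its own summand, which is then run on the second projection.\<close>

lemma trk_case:
  assumes "r \<in> A\<^sub>s" "q \<in> A\<^sub>s"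
  shows "\<exists>c\<in>A\<^sub>s. (\<forall>P R. trk app r P R \<longrightarrow> trk app c (tag k P) R) \<and>
    (\<forall>Q R. trk app q Q R \<longrightarrow> trk app c (tag ki Q) R)"
proof -
  let ?F = "\<lambda>x. pap app (pap app (pap app (pap app (Some x) (Some k)) (Some r)) (Some q))
    (pap app (Some x) (Some ki))"
  have "computable ?F"
    using assms by (intro computable_intros k_mem ki_mem)
  then obtain c where c: "c \<in> A\<^sub>s" "\<And>x. app c x = ?F x"
    by (auto simp: computable_def)
  have left: "app c (pr k a) = app r a" and right: "app c (pr ki a) = app q a" for a
    by (simp_all add: c(2)) (simp add: ki_def)
  have "trk app c (tag k P) R" if "trk app r P R" for P R
    using trkD[OF that] by (intro trkI) (auto simp: tag_def left)
  moreover have "trk app c (tag ki Q) R" if "trk app q Q R" for Q R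
    using trkD[OF that] by (intro trkI) (auto simp: tag_def right)
  ultimately show ?thesis using c(1) by blast
qed

text \<open>Church numerals, so that recursion is application of the numeral.\<close>

fun church :: "nat \<Rightarrow> 'a" where
  "church 0 = k1 cI"
| "church (Suc n) = s2 (s2 (k1 s) k) (church n)"

lemma church_mem [simp]: "church n \<in> A\<^sub>s"
  by (induction n) (simp_all add: k_mem s_mem)

text \<open>With \<open>r\<close> as its only argument a numeral merely builds a closure;
  \<open>r\<close> is run only when the next argument arrives. The recursion equation below
  therefore holds for every \<open>r\<close>, however partial.\<close>

lemma church_defined: "\<exists>d. app (church n) r = Some d"
  by (induction n) auto

lemma app_church_Suc:
  "pap app (app (church (Suc n)) r) (Some a) = pap app (Some r) (pap app (app (church n) r) (Some a))"
  using church_defined[of n r] by auto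

text \<open>The term \<open>s2 (k1 s) k\<close> is the composition combinator, and
  \<open>church (Suc n)\<close> is \<open>s\<close> applied to it and to \<open>church n\<close>;
  leaving out the last argument gives the successor.\<close>

lemma computable_Suc: "\<exists>c\<in>A\<^sub>s. \<forall>n. app c (church n) = Some (church (Suc n))"
  by (rule bexI[of _ "s1 (s2 (k1 s) k)"]) (simp_all add: k_mem s_mem)

lemma iterate_mem:
  assumes "a \<in> P 0" "\<And>n x. x \<in> P n \<Longrightarrow> \<exists>y\<in>P (Suc n). app r x = Some y"
  shows "\<exists>y\<in>P n. pap app (app (church n) r) (Some a) = Some y"
proof (induction n)
  case 0
  then show ?case using assms(1) by simp
next
  case (Suc n)
  then obtain y where "y \<in> P n" "pap app (app (church n) r) (Some a) = Some y"
    by blast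
  with assms(2) show ?case
    by (simp add: app_church_Suc del: church.simps)
qed

lemma computable_iterate:
  assumes "r \<in> A\<^sub>s" "a \<in> A\<^sub>s"
  shows "\<exists>c\<in>A\<^sub>s. \<forall>x. app c x = pap app (app x r) (Some a)"
proof -
  have "computable (\<lambda>x. pap app (pap app (Some x) (Some r)) (Some a))"
    using assms by (intro computable_intros)
  then show ?thesis by (simp add: computable_def)
qed

end

section \<open>Realizing sets in the universe\<close>

locale zfc_sets =
  fixes elts :: "'v \<Rightarrow> 'v set"
  assumes zfc: "zfc_universe elts"
begin

lemma zfc_separation: "S \<subseteq> elts v \<Longrightarrow> \<exists>w. elts w = S"
  and zfc_power: "\<exists>w. elts w = {u. elts u \<subseteq> elts v}"
  and zfc_infinity: "\<exists>v. infinite (elts v)"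
  using zfc by (simp_all add: zfc_universe_def)

text \<open>Carriers are elements of the universe, whereas the constructions below take place on HOL
  sets of various types. This predicate, polymorphic in the element type, marks the sets that can be
  transported into the universe.\<close>

definition small :: "'b set \<Rightarrow> bool" where
  "small S \<longleftrightarrow> (\<exists>v. |S| \<le>o |elts v| )"

lemma elts_small: "small (elts v)"
  unfolding small_def by (blast intro: card_of_mono1)

lemma small_ordLeq: "|S| \<le>o |T| \<Longrightarrow> small T \<Longrightarrow> small S"
  unfolding small_def by (blast intro: ordLeq_transitive)

lemma small_mono: "S \<subseteq> T \<Longrightarrow> small T \<Longrightarrow> small S"
  by (rule small_ordLeq[OF card_of_mono1])

lemma small_countable: "small (S :: nat set)"
proof -
  obtain v where "infinite (elts v)"
    using zfc_infinity by blast
  then have "|UNIV :: nat set| \<le>o |elts v|"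
    by (simp add: infinite_iff_card_of_nat)
  then have "small (UNIV :: nat set)"
    by (auto simp: small_def)
  then show ?thesis by (rule small_mono[rotated]) simp
qed

lemma small_finite:
  fixes S :: "'b set"
  assumes "finite S"
  shows "small S"
proof -
  obtain f :: "'b \<Rightarrow> nat" where "inj_on f S"
    using finite_imp_inj_to_nat_seg[OF assms] by blast
  then have "|S| \<le>o |UNIV :: nat set|"
    using card_of_ordLeq by blast
  then show ?thesis
    using small_countable small_ordLeq by blast
qed

lemma common_bound: "\<exists>w. |elts u| \<le>o |elts w| \<and> |elts v| \<le>o |elts w|"
  using ordLeq_total[OF card_of_Well_order card_of_Well_order, of "elts u" "elts v"]
    ordLeq_refl[OF card_of_Card_order] by blast

lemma small_Times:
  assumes "small S" "small T"
  shows "small (S \<times> T)"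
proof -
  obtain u v where u: "|S| \<le>o |elts u|" and v: "|T| \<le>o |elts v|"
    using assms by (auto simp: small_def)
  \<comment> \<open>The infinite set makes the common bound \<open>w\<close> infinite, so that a
    product of two sets below it stays below it.\<close>
  obtain z where z: "infinite (elts z)"
    using zfc_infinity by blast
  obtain w' where w': "|elts u| \<le>o |elts w'|" "|elts v| \<le>o |elts w'|"
    using common_bound by blast
  obtain w where w: "|elts w'| \<le>o |elts w|" "|elts z| \<le>o |elts w|"
    using common_bound by blast
  have "infinite (elts w)"
    using z w(2) card_of_ordLeq_infinite by blast
  moreover have "|S| \<le>o |elts w|" "|T| \<le>o |elts w|"
    using u v w' w(1) ordLeq_transitive by blast+
  ultimately have "|S \<times> T| \<le>o |elts w|"
    by (simp add: card_of_Sigma_ordLeq_infinite)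
  then show ?thesis by (auto simp: small_def)
qed

text \<open>A subset is coded by an element of the universe whose members are the codes of its
  points; separation supplies that element, and it belongs to the power set of the bound.\<close>

lemma small_Pow:
  assumes "small S"
  shows "small (Pow S)"
proof -
  obtain v f where f: "inj_on f S" "f ` S \<subseteq> elts v"
    using assms by (auto simp: small_def simp flip: card_of_ordLeq)
  obtain w where w: "elts w = {u. elts u \<subseteq> elts v}"
    using zfc_power by blast
  have "\<forall>T. \<exists>u. T \<subseteq> S \<longrightarrow> elts u = f ` T"
    using zfc_separation f(2) by (meson image_mono subset_trans)
  then obtain g where g: "\<And>T. T \<subseteq> S \<Longrightarrow> elts (g T) = f ` T"
    by metis
  have "inj_on g (Pow S)"
  proof (rule inj_onI)
    fix T T'
    assume *: "T \<in> Pow S" "T' \<in> Pow S" "g T = g T'"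
    then have "f ` T = f ` T'"
      using g[of T] g[of T'] by simp
    with f(1) * show "T = T'"
      by (simp add: inj_on_image_eq_iff)
  qed
  moreover have "g ` Pow S \<subseteq> elts w"
    using g f(2) w by (fastforce simp: image_subset_iff)
  ultimately show ?thesis
    using card_of_ordLeq[of "Pow S" "elts w"] unfolding small_def by blast
qed

text \<open>Representing a summand by a singleton next to an empty set reduces sums to power sets
  and products.\<close>

lemma small_Plus:
  assumes "small S" "small T"
  shows "small (S <+> T)"
proof (rule small_ordLeq)
  let ?f = "case_sum (\<lambda>x. ({x}, {})) (\<lambda>y. ({}, {y}))"
  have "inj_on ?f (S <+> T)" "?f ` (S <+> T) \<subseteq> Pow S \<times> Pow T"
    by (auto simp: inj_on_def)
  then show "|S <+> T| \<le>o |Pow S \<times> Pow T|"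
    using card_of_ordLeq by blast
  show "small (Pow S \<times> Pow T)"
    by (intro small_Times small_Pow assms)
qed

lemma small_bij_elts:
  assumes "small S"
  shows "\<exists>v f. bij_betw f S (elts v)"
proof -
  obtain v f where f: "inj_on f S" "f ` S \<subseteq> elts v"
    using assms by (auto simp: small_def simp flip: card_of_ordLeq)
  moreover obtain w where "elts w = f ` S"
    using zfc_separation[OF f(2)] by blast
  ultimately show ?thesis by (metis inj_on_imp_bij_betw)
qed

end

section \<open>The category of assemblies\<close>

locale assembly_category =
  combinatory app A\<^sub>s k s + zfc_sets elts
  for app :: "'a \<Rightarrow> 'a \<Rightarrow> 'a option" and A\<^sub>s k s and elts :: "'v \<Rightarrow> 'v set"
begin

section \<open>Arrows as functions tracked by one element of \<open>A\<^sub>s\<close>\<close>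

abbreviation C :: "(('v, 'a) asm, ('v, 'a) asm_map) cat" where "C \<equiv> Asm elts app A\<^sub>s"
abbreviation el :: "('v, 'a) asm \<Rightarrow> 'v set" where "el X \<equiv> elts (carr X)"
abbreviation asms :: "('v, 'a) asm set" where "asms \<equiv> assemblies elts A\<^sub>s"

lemma Asm_simps [simp]:
  "Obj C = asms" "Arr C = asm_maps elts app A\<^sub>s" "Dom C = src" "Cod C = trg"
  "src (g \<cdot>\<^bsub>C\<^esub> f) = src f" "trg (g \<cdot>\<^bsub>C\<^esub> f) = trg g"
  by (simp_all add: Asm_def)

lemma fn_comp [simp]: "x \<in> el (src f) \<Longrightarrow> fn (g \<cdot>\<^bsub>C\<^esub> f) x = fn g (fn f x)"
  by (simp add: Asm_def compose_def)

lemma fn_comp_extensional: "fn (g \<cdot>\<^bsub>C\<^esub> f) \<in> extensional (el (src f))"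
  by (simp add: Asm_def compose_def)

lemma asmD:
  assumes "X \<in> asms" "x \<in> el X"
  shows "exist X x \<in> Sigma_pca A\<^sub>s" "fst (exist X x) \<noteq> {}"
  using assms by (auto simp: assemblies_def)

lemma asm_snd:
  assumes "X \<in> asms" "x \<in> el X"
  shows "snd (exist X x) \<subseteq> A\<^sub>s" "snd (exist X x) \<subseteq> fst (exist X x)"
  using asmD(1)[OF assms] by (auto simp: Sigma_pca_def)

text \<open>A single index already forces a common element into \<open>A\<^sub>s\<close>. Over the
  empty index set the intersection is the whole pca, and \<open>k\<close> supplies the element of
  \<open>A\<^sub>s\<close>.\<close>

lemma entails_iff:
  "entails app A\<^sub>s I \<phi> \<psi> \<longleftrightarrow> (\<exists>r\<in>A\<^sub>s. \<forall>x\<in>I. trk app r (\<phi> x) (\<psi> x))"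
proof (cases "I = {}")
  case True
  then show ?thesis using k_mem by (auto simp: entails_def)
next
  case False
  then show ?thesis by (auto simp: entails_def sigma_imp_def trk_def ex_in_conv[symmetric])
qed

lemma hom_iff:
  "hom C f X Y \<longleftrightarrow> X \<in> asms \<and> Y \<in> asms \<and> src f = X \<and> trg f = Y \<and> fn f \<in> el X \<rightarrow>\<^sub>E el Y \<and>
     (\<exists>r\<in>A\<^sub>s. \<forall>x\<in>el X. trk app r (exist X x) (exist Y (fn f x)))"
  by (auto simp: hom_def asm_maps_def entails_iff)

lemma homD:
  assumes "hom C f X Y"
  shows "X \<in> asms" "Y \<in> asms" "src f = X" "trg f = Y"
    "\<And>x. x \<in> el X \<Longrightarrow> fn f x \<in> el Y"
    "\<exists>r\<in>A\<^sub>s. \<forall>x\<in>el X. trk app r (exist X x) (exist Y (fn f x))"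
  using assms by (auto simp: hom_iff)

lemma hom_arr: "f \<in> asm_maps elts app A\<^sub>s \<Longrightarrow> hom C f (src f) (trg f)"
  by (simp add: hom_def)

lemma arr_hom: "hom C f X Y \<Longrightarrow> f \<in> asm_maps elts app A\<^sub>s"
  by (simp add: hom_def)

lemma hom_comp:
  assumes "hom C f X Y" "hom C g Y Z"
  shows "hom C (g \<cdot>\<^bsub>C\<^esub> f) X Z"
proof -
  obtain r where r: "r \<in> A\<^sub>s" "\<forall>x\<in>el X. trk app r (exist X x) (exist Y (fn f x))"
    using homD(6)[OF assms(1)] by blast
  obtain q where q: "q \<in> A\<^sub>s" "\<forall>y\<in>el Y. trk app q (exist Y y) (exist Z (fn g y))"
    using homD(6)[OF assms(2)] by blast
  obtain c where c: "c \<in> A\<^sub>s" "\<And>P Q R. trk app r P Q \<Longrightarrow> trk app q Q R \<Longrightarrow> trk app c P R"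
    using trk_comp[OF r(1) q(1)] by blast
  have "\<forall>x\<in>el X. trk app c (exist X x) (exist Z (fn g (fn f x)))"
    using r(2) q(2) homD(5)[OF assms(1)] by (blast intro: c(2))
  then show ?thesis
    using c(1) homD[OF assms(1)] homD[OF assms(2)] fn_comp_extensional[of g f]
    by (auto simp: hom_iff PiE_iff)
qed

lemma hom_eqI:
  assumes "hom C f X Y" "hom C g X Y" "\<And>x. x \<in> el X \<Longrightarrow> fn f x = fn g x"
  shows "f = g"
proof (rule asm_map.expand, intro conjI)
  show "fn f = fn g"
    using assms by (auto simp: hom_iff intro: PiE_ext)
qed (use assms in \<open>simp_all add: hom_iff\<close>)

definition mk :: "('v, 'a) asm \<Rightarrow> ('v, 'a) asm \<Rightarrow> ('v \<Rightarrow> 'v) \<Rightarrow> ('v, 'a) asm_map" where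
  "mk X Y f = Asm_map X Y (restrict f (el X))"

lemma mk_simps [simp]: "src (mk X Y f) = X" "trg (mk X Y f) = Y" "x \<in> el X \<Longrightarrow> fn (mk X Y f) x = f x"
  by (simp_all add: mk_def)

lemma mk_hom:
  assumes "X \<in> asms" "Y \<in> asms" "\<And>x. x \<in> el X \<Longrightarrow> f x \<in> el Y"
    and "r \<in> A\<^sub>s" "\<And>x. x \<in> el X \<Longrightarrow> trk app r (exist X x) (exist Y (f x))"
  shows "hom C (mk X Y f) X Y"
  using assms by (auto simp: hom_iff mk_def)

text \<open>Assemblies may be given on any \<open>small\<close> set of HOL elements; \<open>\<phi>\<close> and \<open>\<psi>\<close> encode them
  in the universe and decode them again.\<close>

definition realizes ::
  "'b set \<Rightarrow> ('b \<Rightarrow> 'a set \<times> 'a set) \<Rightarrow> ('v, 'a) asm \<Rightarrow> ('b \<Rightarrow> 'v) \<Rightarrow> ('v \<Rightarrow> 'b) \<Rightarrow> bool" where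
  "realizes S E X \<phi> \<psi> \<longleftrightarrow> X \<in> asms \<and>
     (\<forall>x\<in>S. \<phi> x \<in> el X \<and> \<psi> (\<phi> x) = x \<and> exist X (\<phi> x) = E x) \<and>
     (\<forall>v\<in>el X. \<psi> v \<in> S \<and> \<phi> (\<psi> v) = v \<and> exist X v = E (\<psi> v))"

lemma realizesD:
  assumes "realizes S E X \<phi> \<psi>"
  shows "X \<in> asms"
    and "\<And>x. x \<in> S \<Longrightarrow> \<phi> x \<in> el X" "\<And>x. x \<in> S \<Longrightarrow> \<psi> (\<phi> x) = x"
    and "\<And>x. x \<in> S \<Longrightarrow> exist X (\<phi> x) = E x"
    and "\<And>v. v \<in> el X \<Longrightarrow> \<psi> v \<in> S" "\<And>v. v \<in> el X \<Longrightarrow> \<phi> (\<psi> v) = v"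
    and "\<And>v. v \<in> el X \<Longrightarrow> exist X v = E (\<psi> v)"
  using assms by (auto simp: realizes_def)

lemma realizes_el:
  assumes "realizes S E X \<phi> \<psi>"
  shows "el X = \<phi> ` S"
proof (intro equalityI subsetI)
  show "v \<in> \<phi> ` S" if "v \<in> el X" for v
    using realizesD(5,6)[OF assms that] by (metis imageI)
qed (use realizesD(2)[OF assms] in blast)

lemma realizes_exists:
  assumes "small S" "\<And>x. x \<in> S \<Longrightarrow> E x \<in> Sigma_pca A\<^sub>s" "\<And>x. x \<in> S \<Longrightarrow> fst (E x) \<noteq> {}"
  obtains X \<phi> \<psi> where "realizes S E X \<phi> \<psi>"
proof -
  obtain v \<phi> where \<phi>: "bij_betw \<phi> S (elts v)"
    using small_bij_elts[OF assms(1)] by blast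
  let ?\<psi> = "inv_into S \<phi>"
  let ?X = "Asm_obj v (\<lambda>x\<in>elts v. E (?\<psi> x))"
  have "?\<psi> y \<in> S" "\<phi> (?\<psi> y) = y" if "y \<in> elts v" for y
    using \<phi> that by (auto simp: bij_betw_def inv_into_into f_inv_into_f)
  moreover have "\<phi> x \<in> elts v" "?\<psi> (\<phi> x) = x" if "x \<in> S" for x
    using \<phi> that by (auto simp: bij_betw_def)
  ultimately have "realizes S E ?X \<phi> ?\<psi>"
    using assms(2,3) by (auto simp: realizes_def assemblies_def)
  then show ?thesis by (rule that)
qed

text \<open>This is the largest pair in \<open>Sigma_pca A\<^sub>s\<close>. Any function into an
  assembly that carries it at every point is an arrow, realized by the identity combinator; the
  comparison object for covers and the object of codes both rely on this.\<close>

lemma top_mem: "(UNIV, A\<^sub>s) \<in> Sigma_pca A\<^sub>s"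
  by (simp add: Sigma_pca_def)

lemma trk_top: "P \<in> Sigma_pca A\<^sub>s \<Longrightarrow> trk app cI P (UNIV, A\<^sub>s)"
  by (rule trkI) (auto simp: Sigma_pca_def)

text \<open>The realizers are recorded because recursion needs them: an arrow out of
  \<open>T\<close> has to yield a starting realizer of the second kind.\<close>

lemma terminal_exists: "\<exists>T t. terminal C T \<and> el T = {t} \<and> exist T t = (UNIV, A\<^sub>s)"
proof -
  obtain T \<phi> \<psi> where T: "realizes {()} (\<lambda>_. (UNIV, A\<^sub>s)) T \<phi> \<psi>"
    by (rule realizes_exists[of "{()}" "\<lambda>_. (UNIV, A\<^sub>s)"]) (simp_all add: small_finite top_mem)
  have el: "el T = {\<phi> ()}"
    using realizes_el[OF T] by simp
  have ex: "exist T (\<phi> ()) = (UNIV, A\<^sub>s)"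
    using realizesD(4)[OF T] by simp
  have "\<exists>!f. hom C f X T" if X: "X \<in> asms" for X
  proof (rule ex_ex1I)
    have "hom C (mk X T (\<lambda>_. \<phi> ())) X T"
      using X by (intro mk_hom[where r = cI]) (auto simp: realizesD(1)[OF T] el ex asmD intro: trk_top)
    then show "\<exists>f. hom C f X T" by blast
    show "f = g" if "hom C f X T" "hom C g X T" for f g
      using that by (rule hom_eqI) (use homD(5)[OF that(1)] homD(5)[OF that(2)] el in auto)
  qed
  then show ?thesis
    using el ex realizesD(1)[OF T] by (intro exI[of _ T] exI[of _ "\<phi> ()"]) (simp add: terminal_def)
qed

lemma initial_exists: "\<exists>Z. initial C Z \<and> el Z = {}"
proof -
  obtain Z \<phi> \<psi> where Z: "realizes ({} :: unit set) (\<lambda>_. (UNIV, A\<^sub>s)) Z \<phi> \<psi>"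
    by (rule realizes_exists[of "{}" "\<lambda>_. (UNIV, A\<^sub>s)"]) (simp_all add: small_finite)
  have el: "el Z = {}"
    using realizes_el[OF Z] by simp
  have "\<exists>!f. hom C f Z X" if X: "X \<in> asms" for X
  proof (rule ex_ex1I)
    have "hom C (mk Z X id) Z X"
      using X by (intro mk_hom[where r = cI]) (auto simp: realizesD(1)[OF Z] el)
    then show "\<exists>f. hom C f Z X" by blast
    show "f = g" if "hom C f Z X" "hom C g Z X" for f g
      using that by (rule hom_eqI) (use el in auto)
  qed
  then show ?thesis
    using el realizesD(1)[OF Z] by (intro exI[of _ Z]) (simp add: initial_def)
qed

text \<open>Points need not be global elements, since \<open>snd (exist X x)\<close> may be empty; a pair of points
  is picked out by maps from a one-element assembly realized by their joint realizers.\<close>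

lemma joint_point:
  assumes X: "X \<in> asms" "x \<in> el X" and Y: "Y \<in> asms" "y \<in> el Y"
  obtains W w f g where "el W = {w}" "hom C f W X" "hom C g W Y" "fn f w = x" "fn g w = y"
proof -
  let ?E = "both (exist X x) (exist Y y)"
  obtain W \<phi> \<psi> where W: "realizes {()} (\<lambda>_. ?E) W \<phi> \<psi>"
    by (rule realizes_exists[of "{()}" "\<lambda>_. ?E"])
      (simp_all add: small_finite both_mem fst_both_nonempty asmD X Y)
  let ?w = "\<phi> ()"
  have el: "el W = {?w}"
    using realizes_el[OF W] by simp
  have ex: "exist W ?w = ?E"
    using realizesD(4)[OF W] by simp
  obtain p where "p \<in> A\<^sub>s" "trk app p ?E (exist X x)"
    using trk_fst by blast
  then have "hom C (mk W X (\<lambda>_. x)) W X"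
    by (intro mk_hom[of _ _ _ p]) (auto simp: realizesD(1)[OF W] X el ex)
  moreover obtain q where "q \<in> A\<^sub>s" "trk app q ?E (exist Y y)"
    using trk_snd by blast
  then have "hom C (mk W Y (\<lambda>_. y)) W Y"
    by (intro mk_hom[of _ _ _ q]) (auto simp: realizesD(1)[OF W] Y el ex)
  ultimately show ?thesis
    using el by (intro that[of W ?w "mk W X (\<lambda>_. x)" "mk W Y (\<lambda>_. y)"]) auto
qed

section \<open>Monos and pullbacks on underlying points\<close>

lemma monic_inj:
  assumes "monic C f"
  shows "inj_on (fn f) (el (src f))"
proof (rule inj_onI)
  fix x y
  assume xy: "x \<in> el (src f)" "y \<in> el (src f)" "fn f x = fn f y"
  have f: "hom C f (src f) (trg f)"
    using assms by (simp add: monic_def hom_arr)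
  then obtain W w u v where W: "el W = {w}" "hom C u W (src f)" "hom C v W (src f)"
    "fn u w = x" "fn v w = y"
    using joint_point[OF homD(1)[OF f] xy(1) homD(1)[OF f] xy(2)] by metis
  have "f \<cdot>\<^bsub>C\<^esub> u = f \<cdot>\<^bsub>C\<^esub> v"
    by (rule hom_eqI[OF hom_comp[OF W(2) f] hom_comp[OF W(3) f]])
      (use W xy(3) in \<open>auto simp: homD(3)[OF W(2)] homD(3)[OF W(3)]\<close>)
  then have "u = v"
    using assms W(2,3) by (auto simp: monic_def)
  then show "x = y" using W by simp
qed

text \<open>Only the universal property is used, so the lemma applies to every pullback square. A
  one-point assembly mapping to both \<open>x\<close> and \<open>b\<close> yields a point of the
  pullback; uniqueness of the mediating arrow makes that point unique.\<close>

lemma pullback_fibre: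
  assumes pb: "pullback C p g f h" and b: "b \<in> el (src h)"
  shows "bij_betw (fn p) (fibre elts g b) (fibre elts f (fn h b))"
proof -
  obtain P X Y A where hs: "hom C p P X" "hom C g P Y" "hom C f X A" "hom C h Y A"
    and comm: "f \<cdot>\<^bsub>C\<^esub> p = h \<cdot>\<^bsub>C\<^esub> g"
    using pb by (auto simp: pullback_def commutes_def)
  note src = homD(3)[OF hs(1)] homD(3)[OF hs(2)] homD(3)[OF hs(3)] homD(3)[OF hs(4)]
  have univ: "\<exists>!m. hom C m (src p') P \<and> p \<cdot>\<^bsub>C\<^esub> m = p' \<and> g \<cdot>\<^bsub>C\<^esub> m = q'"
    if "commutes C p' q' f h" for p' q'
    using pb that src by (simp add: pullback_def)
  have inj: "z = z'" if z: "z \<in> el P" "z' \<in> el P" "fn p z = fn p z'" "fn g z = fn g z'" for z z'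
  proof -
    obtain W w u v where W: "el W = {w}" "hom C u W P" "hom C v W P" "fn u w = z" "fn v w = z'"
      using joint_point[OF homD(1)[OF hs(1)] z(1) homD(1)[OF hs(1)] z(2)] by metis
    note srcW = homD(3)[OF W(2)] homD(3)[OF W(3)]
    have "commutes C (p \<cdot>\<^bsub>C\<^esub> u) (g \<cdot>\<^bsub>C\<^esub> u) f h"
      unfolding commutes_def
    proof (intro conjI)
      note hu = hom_comp[OF W(2) hs(1)] hom_comp[OF W(2) hs(2)]
      show "\<exists>P X Y A. hom C (p \<cdot>\<^bsub>C\<^esub> u) P X \<and> hom C (g \<cdot>\<^bsub>C\<^esub> u) P Y \<and> hom C f X A \<and> hom C h Y A"
        using hu hs by blast
      have "fn f (fn p z) = fn h (fn g z)"
        using arg_cong[OF comm, of "\<lambda>m. fn m z"] z(1) src by simp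
      then show "f \<cdot>\<^bsub>C\<^esub> (p \<cdot>\<^bsub>C\<^esub> u) = h \<cdot>\<^bsub>C\<^esub> (g \<cdot>\<^bsub>C\<^esub> u)"
        by (intro hom_eqI[OF hom_comp[OF hu(1) hs(3)] hom_comp[OF hu(2) hs(4)]])
          (use W z in \<open>auto simp: srcW\<close>)
    qed
    moreover have "p \<cdot>\<^bsub>C\<^esub> v = p \<cdot>\<^bsub>C\<^esub> u"
      by (rule hom_eqI[OF hom_comp[OF W(3) hs(1)] hom_comp[OF W(2) hs(1)]])
        (use W z in \<open>simp add: srcW\<close>)
    moreover have "g \<cdot>\<^bsub>C\<^esub> v = g \<cdot>\<^bsub>C\<^esub> u"
      by (rule hom_eqI[OF hom_comp[OF W(3) hs(2)] hom_comp[OF W(2) hs(2)]])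
        (use W z in \<open>simp add: srcW\<close>)
    ultimately have "u = v"
      using univ[of "p \<cdot>\<^bsub>C\<^esub> u" "g \<cdot>\<^bsub>C\<^esub> u"] W(2,3) unfolding Asm_simps srcW by blast
    then show ?thesis using W by simp
  qed
  have ex: "\<exists>z\<in>el P. fn p z = x \<and> fn g z = b" if x: "x \<in> el X" "fn f x = fn h b" for x
  proof -
    have b': "b \<in> el Y" using b src by simp
    obtain W w u v where W: "el W = {w}" "hom C u W X" "hom C v W Y" "fn u w = x" "fn v w = b"
      using joint_point[OF homD(1)[OF hs(3)] x(1) homD(1)[OF hs(4)] b'] by metis
    note srcW = homD(3)[OF W(2)] homD(3)[OF W(3)]
    have "f \<cdot>\<^bsub>C\<^esub> u = h \<cdot>\<^bsub>C\<^esub> v"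
      by (intro hom_eqI[OF hom_comp[OF W(2) hs(3)] hom_comp[OF W(3) hs(4)]])
        (use W x in \<open>auto simp: srcW\<close>)
    then have "commutes C u v f h"
      unfolding commutes_def using W(2,3) hs(3,4) by blast
    then obtain m where m: "hom C m W P" "p \<cdot>\<^bsub>C\<^esub> m = u" "g \<cdot>\<^bsub>C\<^esub> m = v"
      using univ[of u v] unfolding srcW by blast
    have "fn p (fn m w) = x" "fn g (fn m w) = b"
      using W m(2,3) homD(3)[OF m(1)] fn_comp[of w m] by auto
    moreover have "fn m w \<in> el P"
      using homD(5)[OF m(1)] W(1) by simp
    ultimately show ?thesis by blast
  qed
  have "fn f (fn p z) = fn h (fn g z)" if "z \<in> el P" for z
    using arg_cong[OF comm, of "\<lambda>m. fn m z"] that src by simp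
  then have "fn p ` fibre elts g b \<subseteq> fibre elts f (fn h b)"
    using homD(5)[OF hs(1)] src by (auto simp: fibre_def)
  moreover have "x \<in> fn p ` fibre elts g b" if "x \<in> fibre elts f (fn h b)" for x
    using ex[of x] that src by (auto simp: fibre_def)
  moreover have "inj_on (fn p) (fibre elts g b)"
    using inj src by (auto simp: inj_on_def fibre_def)
  ultimately show ?thesis
    unfolding bij_betw_def by blast
qed

lemma pullback_homD:
  assumes "pullback C p g f h"
  shows "g \<in> asm_maps elts app A\<^sub>s" "f \<in> asm_maps elts app A\<^sub>s" "trg g = src h" "trg h = trg f"
    "h \<in> asm_maps elts app A\<^sub>s"
  using assms by (auto simp: pullback_def commutes_def hom_def)

subsection \<open>Covers\<close>

definition image_exist :: "('v, 'a) asm_map \<Rightarrow> 'v \<Rightarrow> 'a set \<times> 'a set" where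
  "image_exist e y =
     (\<Union>x\<in>fibre elts e y. fst (exist (src e) x), \<Union>x\<in>fibre elts e y. snd (exist (src e) x))"

text \<open>The characteristic function of the image and the constant \<open>True\<close> are both
  arrows into a two-point assembly with trivial realizers. They agree after composition with
  \<open>e\<close>, so the uniqueness clause of the coequalizer identifies them.\<close>

lemma cover_surj:
  assumes "cover C e"
  shows "fn e ` el (src e) = el (trg e)"
proof -
  obtain u v where co: "coequalizer C e u v"
    using assms by (auto simp: cover_def)
  then have e: "hom C e (src e) (trg e)"
    by (simp add: coequalizer_def hom_arr)
  obtain R where uv: "hom C u R (src e)" "hom C v R (src e)"
    using co by (auto simp: coequalizer_def)
  obtain T \<phi> \<psi> where T: "realizes (UNIV :: bool set) (\<lambda>_. (UNIV, A\<^sub>s)) T \<phi> \<psi>"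
    by (rule realizes_exists[of "UNIV :: bool set" "\<lambda>_. (UNIV, A\<^sub>s)"])
      (simp_all add: small_finite top_mem)
  define a b where "a = mk (trg e) T (\<lambda>y. \<phi> (y \<in> fn e ` el (src e)))" and "b = mk (trg e) T (\<lambda>y. \<phi> True)"
  have ab: "hom C a (trg e) T" "hom C b (trg e) T"
    unfolding a_def b_def
    by (rule mk_hom[OF homD(2)[OF e] realizesD(1)[OF T] _ cI_mem];
      use homD(2)[OF e] in \<open>auto simp: realizesD(2,4)[OF T] asmD intro: trk_top\<close>)+
  have eq: "a \<cdot>\<^bsub>C\<^esub> e = b \<cdot>\<^bsub>C\<^esub> e"
    by (rule hom_eqI[OF hom_comp[OF e ab(1)] hom_comp[OF e ab(2)]])
      (use homD(5)[OF e] in \<open>auto simp: a_def b_def\<close>)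
  have eq2: "(b \<cdot>\<^bsub>C\<^esub> e) \<cdot>\<^bsub>C\<^esub> u = (b \<cdot>\<^bsub>C\<^esub> e) \<cdot>\<^bsub>C\<^esub> v"
    by (rule hom_eqI[OF hom_comp[OF uv(1) hom_comp[OF e ab(2)]] hom_comp[OF uv(2) hom_comp[OF e ab(2)]]])
      (use homD(5)[OF e] homD(5)[OF uv(1)] homD(5)[OF uv(2)]
        in \<open>auto simp: b_def homD(3)[OF uv(1)] homD(3)[OF uv(2)]\<close>)
  have "\<exists>!m. hom C m (trg e) T \<and> m \<cdot>\<^bsub>C\<^esub> e = b \<cdot>\<^bsub>C\<^esub> e"
    using co hom_comp[OF e ab(2)] eq2 by (simp add: coequalizer_def)
  then have "a = b" using ab eq by blast
  then have "\<phi> (y \<in> fn e ` el (src e)) = \<phi> True" if "y \<in> el (trg e)" for y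
    using arg_cong[OF \<open>a = b\<close>, of "\<lambda>m. fn m y"]
    unfolding a_def b_def mk_simps(3)[OF that] by blast
  then have "y \<in> fn e ` el (src e)" if "y \<in> el (trg e)" for y
    using that realizesD(3)[OF T] by (metis UNIV_I)
  then show ?thesis using homD(5)[OF e] by blast
qed

lemma cover_arr: "cover C e \<Longrightarrow> e \<in> asm_maps elts app A\<^sub>s"
  by (auto simp: cover_def coequalizer_def)

text \<open>The coequalizer is compared with its domain's quotient carrying the union of the
  realizers in each fibre.\<close>

lemma cover_trk:
  assumes "cover C e"
  shows "\<exists>r\<in>A\<^sub>s. \<forall>y\<in>el (trg e). trk app r (exist (trg e) y) (image_exist e y)"
proof -
  obtain u v where co: "coequalizer C e u v"
    using assms by (auto simp: cover_def)
  have e: "hom C e (src e) (trg e)"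
    using cover_arr[OF assms] by (rule hom_arr)
  note X = homD(1)[OF e]
  obtain R where uv: "hom C u R (src e)" "hom C v R (src e)" and euv: "e \<cdot>\<^bsub>C\<^esub> u = e \<cdot>\<^bsub>C\<^esub> v"
    using co by (auto simp: coequalizer_def)
  define Q where "Q = Asm_obj (carr (trg e)) (\<lambda>y\<in>el (trg e). image_exist e y)"
  have "image_exist e y \<in> Sigma_pca A\<^sub>s" for y
    using asmD(1)[OF X] by (fastforce simp: image_exist_def Sigma_pca_def fibre_def)
  moreover have "fst (image_exist e y) \<noteq> {}" if "y \<in> el (trg e)" for y
    using that asmD(2)[OF X] unfolding cover_surj[OF assms, symmetric]
    by (fastforce simp: image_exist_def fibre_def)
  ultimately have Q: "Q \<in> asms"
    by (auto simp: Q_def assemblies_def)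
  define h where "h = mk (src e) Q (fn e)"
  have h: "hom C h (src e) Q"
    unfolding h_def
  proof (rule mk_hom[OF X Q _ cI_mem])
    show "fn e x \<in> el Q" if "x \<in> el (src e)" for x
      using that homD(5)[OF e] by (simp add: Q_def)
    show "trk app cI (exist (src e) x) (exist Q (fn e x))" if "x \<in> el (src e)" for x
      using that homD(5)[OF e] by (intro trkI) (auto simp: Q_def image_exist_def fibre_def)
  qed
  have "fn e (fn u x) = fn e (fn v x)" if "x \<in> el R" for x
    using arg_cong[OF euv, of "\<lambda>m. fn m x"] that by (simp add: homD(3)[OF uv(1)] homD(3)[OF uv(2)])
  then have "h \<cdot>\<^bsub>C\<^esub> u = h \<cdot>\<^bsub>C\<^esub> v"
    by (intro hom_eqI[OF hom_comp[OF uv(1) h] hom_comp[OF uv(2) h]])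
      (use homD(5)[OF uv(1)] homD(5)[OF uv(2)] in \<open>auto simp: h_def homD(3)[OF uv(1)] homD(3)[OF uv(2)]\<close>)
  then have "\<exists>!m. hom C m (trg e) Q \<and> m \<cdot>\<^bsub>C\<^esub> e = h"
    using co h by (simp add: coequalizer_def)
  then obtain m where m: "hom C m (trg e) Q" "m \<cdot>\<^bsub>C\<^esub> e = h"
    by blast
  \<comment> \<open>The mediating arrow is the identity on points, so whatever realizes it converts
    realizers of \<open>y\<close> in the codomain into realizers of points of the fibre.\<close>
  have "fn m y = y" if y: "y \<in> el (trg e)" for y
  proof -
    obtain x where x: "x \<in> el (src e)" "y = fn e x"
      using y cover_surj[OF assms] by blast
    then show ?thesis
      using arg_cong[OF m(2), of "\<lambda>m. fn m x"] by (simp add: h_def)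
  qed
  with homD(6)[OF m(1)] show ?thesis
    by (simp add: Q_def)
qed

text \<open>Such a map is the coequalizer of its kernel pair, taken with joint realizers. An arrow
  \<open>h\<close> that equalizes the kernel pair is constant on fibres and descends to
  \<open>Y\<close>; the descended function is realized by \<open>r\<close> followed by a realizer of
  \<open>h\<close>.\<close>

lemma coverI:
  assumes e: "hom C e X Y" and surj: "fn e ` el X = el Y"
    and r: "r \<in> A\<^sub>s" "\<And>y. y \<in> el Y \<Longrightarrow> trk app r (exist Y y) (image_exist e y)"
  shows "cover C e"
proof -
  note X = homD(1)[OF e] and Y = homD(2)[OF e] and src = homD(3)[OF e] and trg = homD(4)[OF e]
  let ?S = "{(x, x'). x \<in> el X \<and> x' \<in> el X \<and> fn e x = fn e x'}"
  let ?E = "\<lambda>(x, x'). both (exist X x) (exist X x')"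
  have "small ?S"
    by (rule small_mono[OF _ small_Times[OF elts_small elts_small]]) auto
  then obtain K \<phi> \<psi> where K: "realizes ?S ?E K \<phi> \<psi>"
    by (rule realizes_exists[of ?S ?E]) (auto simp: both_mem fst_both_nonempty asmD[OF X])
  obtain p where p: "p \<in> A\<^sub>s" "\<And>P Q. trk app p (both P Q) P"
    using trk_fst by blast
  obtain q where q: "q \<in> A\<^sub>s" "\<And>P Q. trk app q (both P Q) Q"
    using trk_snd by blast
  define u v where "u = mk K X (fst \<circ> \<psi>)" and "v = mk K X (snd \<circ> \<psi>)"
  have u: "hom C u K X"
    unfolding u_def using realizesD(5)[OF K]
    by (intro mk_hom[OF realizesD(1)[OF K] X _ p(1)]) (fastforce simp: realizesD(7)[OF K] p(2) split_def)+
  have v: "hom C v K X"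
    unfolding v_def using realizesD(5)[OF K]
    by (intro mk_hom[OF realizesD(1)[OF K] X _ q(1)]) (fastforce simp: realizesD(7)[OF K] q(2) split_def)+
  have uv: "e \<cdot>\<^bsub>C\<^esub> u = e \<cdot>\<^bsub>C\<^esub> v"
    using realizesD(5)[OF K]
    by (intro hom_eqI[OF hom_comp[OF u e] hom_comp[OF v e]]) (fastforce simp: u_def v_def)
  have "\<exists>!m. hom C m Y Z \<and> m \<cdot>\<^bsub>C\<^esub> e = h" if h: "hom C h X Z" and huv: "h \<cdot>\<^bsub>C\<^esub> u = h \<cdot>\<^bsub>C\<^esub> v" for Z h
  proof (rule ex_ex1I)
    have const: "fn h x = fn h x'" if "x \<in> el X" "x' \<in> el X" "fn e x = fn e x'" for x x'
    proof -
      have "(x, x') \<in> ?S" using that by simp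
      note xx = realizesD(2)[OF K this] realizesD(3)[OF K this]
      show ?thesis
        using arg_cong[OF huv, of "\<lambda>m. fn m (\<phi> (x, x'))"] xx by (simp add: u_def v_def)
    qed
    define m where "m = (\<lambda>y. fn h (inv_into (el X) (fn e) y))"
    have m: "m (fn e x) = fn h x" if "x \<in> el X" for x
      unfolding m_def using that by (intro const) (auto simp: inv_into_into f_inv_into_f)
    obtain t where t: "t \<in> A\<^sub>s" "\<And>x. x \<in> el X \<Longrightarrow> trk app t (exist X x) (exist Z (fn h x))"
      using homD(6)[OF h] by blast
    obtain c where c: "c \<in> A\<^sub>s" "\<And>P Q R. trk app r P Q \<Longrightarrow> trk app t Q R \<Longrightarrow> trk app c P R"
      using trk_comp[OF r(1) t(1)] by blast
    \<comment> \<open>It does not matter which point of the fibre a realizer belongs to, since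
      \<open>h\<close> takes the same value \<open>m y\<close> on all of them.\<close>
    have "trk app t (image_exist e y) (exist Z (m y))" for y
      by (rule trkI) (auto simp: image_exist_def fibre_def src m dest: trkD[OF t(2)])
    then have "trk app c (exist Y y) (exist Z (m y))" if "y \<in> el Y" for y
      using c(2) r(2) that by blast
    moreover have "m y \<in> el Z" if "y \<in> el Y" for y
      using that m homD(5)[OF h] unfolding surj[symmetric] by auto
    ultimately have mm: "hom C (mk Y Z m) Y Z"
      by (intro mk_hom[OF Y homD(2)[OF h] _ c(1)])
    moreover have "mk Y Z m \<cdot>\<^bsub>C\<^esub> e = h"
      by (rule hom_eqI[OF hom_comp[OF e mm] h]) (use homD(5)[OF e] in \<open>auto simp: src m\<close>)
    ultimately show "\<exists>m. hom C m Y Z \<and> m \<cdot>\<^bsub>C\<^esub> e = h" by blast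
    fix m m' assume *: "hom C m Y Z \<and> m \<cdot>\<^bsub>C\<^esub> e = h" "hom C m' Y Z \<and> m' \<cdot>\<^bsub>C\<^esub> e = h"
    show "m = m'"
    proof (rule hom_eqI)
      fix y assume "y \<in> el Y"
      then obtain x where "x \<in> el X" "y = fn e x"
        using surj by blast
      then show "fn m y = fn m' y"
        using * src by (metis fn_comp)
    qed (use * in blast)+
  qed
  then have "coequalizer C e u v"
    using u v uv arr_hom[OF e] by (auto simp: coequalizer_def src trg)
  then show ?thesis by (auto simp: cover_def)
qed

section \<open>Identity arrows and squares over an identity\<close>

definition idm :: "('v, 'a) asm \<Rightarrow> ('v, 'a) asm_map" where "idm X = mk X X (\<lambda>x. x)"

lemma idm_simps [simp]: "src (idm X) = X" "trg (idm X) = X" "x \<in> el X \<Longrightarrow> fn (idm X) x = x"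
  by (simp_all add: idm_def)

lemma idm_hom: "X \<in> asms \<Longrightarrow> hom C (idm X) X X"
  unfolding idm_def by (rule mk_hom[OF _ _ _ cI_mem]) (auto simp: trk_id)

lemma comp_idm: "hom C f X Y \<Longrightarrow> f \<cdot>\<^bsub>C\<^esub> idm X = f"
  by (rule hom_eqI[OF hom_comp[OF idm_hom]]) (auto simp: homD)

lemma idm_comp: "hom C f X Y \<Longrightarrow> idm Y \<cdot>\<^bsub>C\<^esub> f = f"
  by (rule hom_eqI[OF hom_comp[OF _ idm_hom]]) (auto simp: homD)

lemma cover_idm:
  assumes "X \<in> asms"
  shows "cover C (idm X)"
proof (rule coverI[OF idm_hom[OF assms] _ cI_mem])
  show "fn (idm X) ` el X = el X" by force
  show "trk app cI (exist X y) (image_exist (idm X) y)" if "y \<in> el X" for y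
    using that by (intro trkI) (auto simp: image_exist_def fibre_def)
qed

lemma pullback_idm:
  assumes f: "hom C f X Y"
  shows "pullback C (idm X) f f (idm Y)"
  unfolding pullback_def
proof (intro conjI allI impI)
  show "commutes C (idm X) f f (idm Y)"
    using f idm_hom[OF homD(1)[OF f]] idm_hom[OF homD(2)[OF f]]
    by (auto simp: commutes_def comp_idm[OF f] idm_comp[OF f])
  fix p q assume "commutes C p q f (idm Y)"
  then obtain P where pq: "hom C p P X" "hom C q P Y" "f \<cdot>\<^bsub>C\<^esub> p = idm Y \<cdot>\<^bsub>C\<^esub> q"
    using homD(3)[OF f] by (auto simp: commutes_def hom_def)
  then have q: "f \<cdot>\<^bsub>C\<^esub> p = q" by (simp add: idm_comp)
  show "\<exists>!m. hom C m (Dom C p) (Dom C (idm X)) \<and> idm X \<cdot>\<^bsub>C\<^esub> m = p \<and> f \<cdot>\<^bsub>C\<^esub> m = q"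
    unfolding Asm_simps idm_simps homD(3)[OF pq(1)]
  proof (rule ex1I[of _ p])
    show "hom C p P X \<and> idm X \<cdot>\<^bsub>C\<^esub> p = p \<and> f \<cdot>\<^bsub>C\<^esub> p = q"
      using pq(1) q idm_comp by blast
    show "m = p" if "hom C m P X \<and> idm X \<cdot>\<^bsub>C\<^esub> m = p \<and> f \<cdot>\<^bsub>C\<^esub> m = q" for m
      using that idm_comp[of m P X] by simp
  qed
qed

text \<open>Along an identity \<open>f\<close> is its own pullback, so the mediating arrow is
  \<open>p\<close> itself. Both Collection and Representability end with this square.\<close>

lemma quasi_pullback_idm:
  assumes f: "hom C f X Y" and p: "cover C p" "hom C p Z X"
  shows "quasi_pullback C p (f \<cdot>\<^bsub>C\<^esub> p) f (idm Y)"
proof -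
  have "commutes C p (f \<cdot>\<^bsub>C\<^esub> p) f (idm Y)"
    using f p idm_hom[OF homD(2)[OF f]] hom_comp[OF p(2) f]
    unfolding commutes_def by (metis idm_comp)
  then show ?thesis
    unfolding quasi_pullback_def using pullback_idm[OF f] p idm_comp[OF p(2)]
    by (metis Asm_simps(3) homD(3) idm_simps(1))
qed

subsection \<open>Sums and natural numbers\<close>

text \<open>Realizers are tagged by the selectors \<open>k\<close> and \<open>ki\<close>, which
  makes copairing a case distinction. The decomposition of the carrier is part of the conclusion
  because the fibres of a sum of maps are computed from it.\<close>

lemma coproduct_exists:
  assumes X: "X \<in> asms" and Y: "Y \<in> asms"
  obtains P i j where "coproduct C P i j" "hom C i X P" "hom C j Y P"
    "inj_on (fn i) (el X)" "inj_on (fn j) (el Y)"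
    "el P = fn i ` el X \<union> fn j ` el Y" "fn i ` el X \<inter> fn j ` el Y = {}"
proof -
  let ?S = "el X <+> el Y"
  let ?E = "case_sum (\<lambda>x. tag k (exist X x)) (\<lambda>y. tag ki (exist Y y))"
  have "small ?S" by (intro small_Plus elts_small)
  then obtain P \<phi> \<psi> where P: "realizes ?S ?E P \<phi> \<psi>"
    by (rule realizes_exists[of ?S ?E])
      (auto simp: tag_mem fst_tag_nonempty asmD[OF X] asmD[OF Y] k_mem)
  note Pr = realizesD[OF P]
  define i j where "i = mk X P (\<lambda>x. \<phi> (Inl x))" and "j = mk Y P (\<lambda>y. \<phi> (Inr y))"
  have inl: "\<phi> (Inl x) \<in> el P" "exist P (\<phi> (Inl x)) = tag k (exist X x)" "\<psi> (\<phi> (Inl x)) = Inl x"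
    if "x \<in> el X" for x
    using Pr(2-4)[OF InlI[OF that]] by simp_all
  have inr: "\<phi> (Inr y) \<in> el P" "exist P (\<phi> (Inr y)) = tag ki (exist Y y)" "\<psi> (\<phi> (Inr y)) = Inr y"
    if "y \<in> el Y" for y
    using Pr(2-4)[OF InrI[OF that]] by simp_all
  obtain r where r: "r \<in> A\<^sub>s" "\<And>P. trk app r P (tag k P)"
    using trk_tag[OF k_mem] by blast
  obtain q where q: "q \<in> A\<^sub>s" "\<And>P. trk app q P (tag ki P)"
    using trk_tag[OF ki_mem] by blast
  have i: "hom C i X P"
    unfolding i_def by (rule mk_hom[OF X Pr(1) _ r(1)]) (auto simp: inl r(2))
  have j: "hom C j Y P"
    unfolding j_def by (rule mk_hom[OF Y Pr(1) _ q(1)]) (auto simp: inr q(2))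
  have fni: "fn i x = \<phi> (Inl x)" if "x \<in> el X" for x
    using that by (simp add: i_def)
  have fnj: "fn j y = \<phi> (Inr y)" if "y \<in> el Y" for y
    using that by (simp add: j_def)
  have "fn i ` el X = \<phi> ` Inl ` el X" "fn j ` el Y = \<phi> ` Inr ` el Y"
    by (auto simp: image_image fni fnj)
  then have cov: "el P = fn i ` el X \<union> fn j ` el Y"
    by (simp add: realizes_el[OF P] Plus_def image_Un)
  have "\<exists>!m. hom C m P Z \<and> m \<cdot>\<^bsub>C\<^esub> i = f \<and> m \<cdot>\<^bsub>C\<^esub> j = g"
    if f: "hom C f X Z" and g: "hom C g Y Z" for Z f g
  proof (rule ex_ex1I)
    define m where "m = mk P Z (\<lambda>v. case_sum (fn f) (fn g) (\<psi> v))"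
    obtain a where a: "a \<in> A\<^sub>s" "\<And>x. x \<in> el X \<Longrightarrow> trk app a (exist X x) (exist Z (fn f x))"
      using homD(6)[OF f] by blast
    obtain b where b: "b \<in> A\<^sub>s" "\<And>y. y \<in> el Y \<Longrightarrow> trk app b (exist Y y) (exist Z (fn g y))"
      using homD(6)[OF g] by blast
    obtain c where c: "c \<in> A\<^sub>s" "\<And>P R. trk app a P R \<Longrightarrow> trk app c (tag k P) R"
        "\<And>Q R. trk app b Q R \<Longrightarrow> trk app c (tag ki Q) R"
      using trk_case[OF a(1) b(1)] by blast
    have m: "hom C m P Z"
      unfolding m_def
    proof (rule mk_hom[OF Pr(1) homD(2)[OF f] _ c(1)])
      fix v assume v: "v \<in> el P"
      show "case_sum (fn f) (fn g) (\<psi> v) \<in> el Z"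
        using Pr(5)[OF v] homD(5)[OF f] homD(5)[OF g] by auto
      show "trk app c (exist P v) (exist Z (case_sum (fn f) (fn g) (\<psi> v)))"
        unfolding Pr(7)[OF v] using Pr(5)[OF v] c(2)[OF a(2)] c(3)[OF b(2)] by auto
    qed
    have "m \<cdot>\<^bsub>C\<^esub> i = f"
      using homD(3)[OF i] homD(5)[OF i]
      by (intro hom_eqI[OF hom_comp[OF i m] f]) (auto simp: m_def fni inl(3))
    moreover have "m \<cdot>\<^bsub>C\<^esub> j = g"
      using homD(3)[OF j] homD(5)[OF j]
      by (intro hom_eqI[OF hom_comp[OF j m] g]) (auto simp: m_def fnj inr(3))
    ultimately show "\<exists>m. hom C m P Z \<and> m \<cdot>\<^bsub>C\<^esub> i = f \<and> m \<cdot>\<^bsub>C\<^esub> j = g"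
      using m by blast
    fix m n
    assume m: "hom C m P Z \<and> m \<cdot>\<^bsub>C\<^esub> i = f \<and> m \<cdot>\<^bsub>C\<^esub> j = g"
      and n: "hom C n P Z \<and> n \<cdot>\<^bsub>C\<^esub> i = f \<and> n \<cdot>\<^bsub>C\<^esub> j = g"
    have "m \<cdot>\<^bsub>C\<^esub> i = n \<cdot>\<^bsub>C\<^esub> i" "m \<cdot>\<^bsub>C\<^esub> j = n \<cdot>\<^bsub>C\<^esub> j"
      using m n by simp_all
    then have mi: "fn m (fn i x) = fn n (fn i x)" if "x \<in> el X" for x
      using that homD(3)[OF i] by (metis fn_comp)
    have mj: "fn m (fn j y) = fn n (fn j y)" if "y \<in> el Y" for y
      using \<open>m \<cdot>\<^bsub>C\<^esub> j = n \<cdot>\<^bsub>C\<^esub> j\<close> that homD(3)[OF j] by (metis fn_comp)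
    show "m = n"
      by (rule hom_eqI[of _ P Z]) (use m n mi mj cov in auto)
  qed
  then have "coproduct C P i j"
    using i j by (simp add: coproduct_def homD(3)[OF i] homD(3)[OF j])
  moreover have "inj_on (fn i) (el X)" "inj_on (fn j) (el Y)" "fn i ` el X \<inter> fn j ` el Y = {}"
    using inl(3) inr(3) by (auto simp: inj_on_def fni fnj) (metis sum.inject sum.distinct(1))+
  ultimately show ?thesis
    by (intro that[OF _ i j _ _ cov])
qed

text \<open>The start \<open>a\<close> is hard-wired into the program, so one and the same element
  of \<open>A\<^sub>s\<close> has to serve both components of \<open>P 0\<close>.\<close>

lemma iterate_trk:
  assumes "r \<in> A\<^sub>s" "a \<in> A\<^sub>s" "a \<in> fst (P 0)" "a \<in> snd (P 0)" "\<And>n. trk app r (P n) (P (Suc n))"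
  shows "\<exists>c\<in>A\<^sub>s. \<forall>n. trk app c ({church n}, {church n}) (P n)"
proof -
  obtain c where c: "c \<in> A\<^sub>s" "\<And>x. app c x = pap app (app x r) (Some a)"
    using computable_iterate[OF assms(1,2)] by blast
  have "trk app c ({church n}, {church n}) (P n)" for n
  proof (rule trkI)
    show "\<exists>b\<in>fst (P n). app c x = Some b" if "x \<in> fst ({church n}, {church n})" for x
      using that iterate_mem[of a "fst \<circ> P" r n] assms(3) trkD(1)[OF assms(5)] by (simp add: c(2))
    show "\<exists>b\<in>snd (P n). app c x = Some b" if "x \<in> snd ({church n}, {church n})" for x
      using that iterate_mem[of a "snd \<circ> P" r n] assms(4) trkD(2)[OF assms(5)] by (simp add: c(2))
  qed
  then show ?thesis using c(1) by blast
qed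

text \<open>Each number has its numeral as its only realizer, of both kinds, so the recursor is
  realized by applying the numeral to a realizer of the step. The size bound prepares the axiom of
  infinity.\<close>

lemma nno_exists:
  "\<exists>T N. natural_numbers_object C T N \<and> |el N| \<le>o |UNIV :: nat set|"
proof -
  obtain T t where T: "terminal C T" "el T = {t}" "exist T t = (UNIV, A\<^sub>s)"
    using terminal_exists by blast
  have Tobj: "T \<in> asms" using T(1) by (simp add: terminal_def)
  let ?E = "\<lambda>n. ({church n}, {church n})"
  obtain N \<phi> \<psi> where N: "realizes (UNIV :: nat set) ?E N \<phi> \<psi>"
    by (rule realizes_exists[of "UNIV :: nat set" ?E]) (auto simp: small_countable Sigma_pca_def)
  have Nobj: "N \<in> asms" and \<phi>: "\<phi> n \<in> el N" and \<psi>: "\<psi> (\<phi> n) = n" and ex: "exist N (\<phi> n) = ?E n" for n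
    using realizesD[OF N] by auto
  have el: "el N = range \<phi>" by (rule realizes_el[OF N])
  define z where "z = mk T N (\<lambda>_. \<phi> 0)"
  define s' where "s' = mk N N (\<lambda>v. \<phi> (Suc (\<psi> v)))"
  have trk0: "trk app (k1 (church 0)) (UNIV, A\<^sub>s) (?E 0)"
    by (intro trkI) (simp_all del: church.simps)
  have z: "hom C z T N"
    unfolding z_def
    by (rule mk_hom[OF Tobj Nobj _ k1_mem[OF church_mem[of 0]]]) (use trk0 in \<open>simp_all add: \<phi> ex T\<close>)
  obtain c where c: "c \<in> A\<^sub>s" "\<And>n. app c (church n) = Some (church (Suc n))"
    using computable_Suc by blast
  have s': "hom C s' N N"
    unfolding s'_def
    by (rule mk_hom[OF Nobj Nobj _ c(1)]) (auto simp: el ex \<psi> c(2) intro!: trkI simp del: church.simps)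
  have "\<exists>!u. hom C u N X \<and> u \<cdot>\<^bsub>C\<^esub> z = a \<and> u \<cdot>\<^bsub>C\<^esub> s' = f \<cdot>\<^bsub>C\<^esub> u"
    if a: "hom C a T X" and f: "hom C f X X" for X a f
  proof (rule ex_ex1I)
    define x where "x = (\<lambda>n. (fn f ^^ n) (fn a t))"
    have x: "x n \<in> el X" for n
      unfolding x_def by (induction n) (use homD(5)[OF a] homD(5)[OF f] T(2) in auto)
    have X: "X \<in> asms" by (rule homD(1)[OF f])
    obtain q where q: "trk app q (exist T t) (exist X (fn a t))"
      using homD(6)[OF a] T(2) by blast
    \<comment> \<open>Since \<open>k\<close> is a realizer of \<open>t\<close> of the second kind,
      \<open>q\<close> sends it to one of the initial value; this provides the start of the
      iteration.\<close>
    obtain d where d: "d \<in> snd (exist X (fn a t))"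
      using trkD(2)[OF q, of k] T(3) k_mem by auto
    have "d \<in> A\<^sub>s" "d \<in> fst (exist X (x 0))" "d \<in> snd (exist X (x 0))"
      using d asm_snd[OF X x[of 0]] by (auto simp: x_def)
    moreover obtain r where r: "r \<in> A\<^sub>s" "\<And>y. y \<in> el X \<Longrightarrow> trk app r (exist X y) (exist X (fn f y))"
      using homD(6)[OF f] by blast
    moreover have "trk app r (exist X (x n)) (exist X (x (Suc n)))" for n
      using r(2)[OF x[of n]] by (simp add: x_def)
    ultimately obtain e where e: "e \<in> A\<^sub>s" "\<And>n. trk app e (?E n) (exist X (x n))"
      using iterate_trk[of r d "\<lambda>n. exist X (x n)"] by blast
    define u where "u = mk N X (\<lambda>v. x (\<psi> v))"
    have u: "hom C u N X"
      unfolding u_def by (rule mk_hom[OF Nobj X _ e(1)]) (auto simp: el ex \<psi> x e(2))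
    have "u \<cdot>\<^bsub>C\<^esub> z = a"
      using \<phi> by (intro hom_eqI[OF hom_comp[OF z u] a]) (auto simp: u_def z_def \<psi> x_def T(2))
    moreover have "u \<cdot>\<^bsub>C\<^esub> s' = f \<cdot>\<^bsub>C\<^esub> u"
      using \<phi> by (intro hom_eqI[OF hom_comp[OF s' u] hom_comp[OF u f]])
        (auto simp: u_def s'_def \<psi> x_def el)
    ultimately show "\<exists>u. hom C u N X \<and> u \<cdot>\<^bsub>C\<^esub> z = a \<and> u \<cdot>\<^bsub>C\<^esub> s' = f \<cdot>\<^bsub>C\<^esub> u"
      using u by blast
    have fn_numeral: "fn u (\<phi> n) = x n"
      if u: "hom C u N X" "u \<cdot>\<^bsub>C\<^esub> z = a" "u \<cdot>\<^bsub>C\<^esub> s' = f \<cdot>\<^bsub>C\<^esub> u" for u n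
    proof (induction n)
      case 0
      show ?case
        using arg_cong[OF u(2), of "\<lambda>m. fn m t"] T(2) by (simp add: z_def x_def)
    next
      case (Suc n)
      then show ?case
        using arg_cong[OF u(3), of "\<lambda>m. fn m (\<phi> n)"] \<phi>
        by (simp add: s'_def \<psi> x_def homD(3)[OF u(1)])
    qed
    fix u v
    assume "hom C u N X \<and> u \<cdot>\<^bsub>C\<^esub> z = a \<and> u \<cdot>\<^bsub>C\<^esub> s' = f \<cdot>\<^bsub>C\<^esub> u"
      and "hom C v N X \<and> v \<cdot>\<^bsub>C\<^esub> z = a \<and> v \<cdot>\<^bsub>C\<^esub> s' = f \<cdot>\<^bsub>C\<^esub> v"
    then show "u = v"
      by (intro hom_eqI[of u N X v]) (auto simp: el fn_numeral)
  qed
  then have "natural_numbers_object C T N"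
    unfolding natural_numbers_object_def using T(1) z s' by blast
  moreover have "|el N| \<le>o |UNIV :: nat set|"
    unfolding el by (rule card_of_image)
  ultimately show ?thesis by blast
qed

end

section \<open>Small maps\<close>

text \<open>The cardinal \<kappa> is a relation on a type unrelated to the universe;
  \<open>\<kappa>_in_universe\<close> says that it is the cardinality of a set of the
  universe.\<close>

locale small_assembly_maps = assembly_category app A\<^sub>s k s elts
  for app :: "'a \<Rightarrow> 'a \<Rightarrow> 'a option" and A\<^sub>s k s and elts :: "'v \<Rightarrow> 'v set" +
  fixes \<kappa> :: "'k rel"
  assumes inaccessible: "strongly_inaccessible \<kappa>"
    and \<kappa>_in_universe: "\<exists>c. \<kappa> =o |elts c|"
    and card_pca: "|UNIV :: 'a set| <o \<kappa>"
begin

abbreviation Sm :: "('v, 'a) asm_map set" where "Sm \<equiv> small_maps elts app A\<^sub>s \<kappa>"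

section \<open>Cardinal bounds below \<kappa>\<close>

lemma Cinfinite_\<kappa>: "Cinfinite \<kappa>"
proof -
  have \<kappa>: "Card_order \<kappa>" "natLeq <o \<kappa>"
    using inaccessible by (auto simp: strongly_inaccessible_def)
  then have "natLeq \<le>o |Field \<kappa>|"
    using card_of_Field_ordIso ordIso_symmetric ordLess_imp_ordLeq ordLeq_ordIso_trans by blast
  then show ?thesis
    using \<kappa>(1) infinite_iff_natLeq_ordLeq by (auto simp: cinfinite_def)
qed

lemma finite_ordLess_\<kappa>:
  assumes "finite S"
  shows "|S| <o \<kappa>"
proof (rule ordLess_transitive)
  show "|S| <o natLeq" using assms by (simp add: finite_iff_ordLess_natLeq)
  show "natLeq <o \<kappa>" using inaccessible by (simp add: strongly_inaccessible_def)
qed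

lemma UN_ordLess_\<kappa>:
  assumes "|I| <o \<kappa>" "\<And>x. x \<in> I \<Longrightarrow> |F x| <o \<kappa>"
  shows "|\<Union>x\<in>I. F x| <o \<kappa>"
  using regularCard_UNION_bound[OF Cinfinite_\<kappa> _ assms] inaccessible
  by (simp add: strongly_inaccessible_def)

lemma subset_ordLess_\<kappa>: "S \<subseteq> T \<Longrightarrow> |T| <o \<kappa> \<Longrightarrow> |S| <o \<kappa>"
  by (rule ordLeq_ordLess_trans[OF card_of_mono1])

lemma image_ordLess_\<kappa>: "|T| <o \<kappa> \<Longrightarrow> |f ` T| <o \<kappa>"
  by (rule ordLeq_ordLess_trans[OF card_of_image])

lemma small_pca: "small (S :: 'a set)"
proof -
  obtain c where "\<kappa> =o |elts c|" using \<kappa>_in_universe by blast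
  then have "|UNIV :: 'a set| \<le>o |elts c|"
    using card_pca ordLess_imp_ordLeq ordLeq_ordIso_trans by blast
  then have "small (UNIV :: 'a set)" by (auto simp: small_def)
  then show ?thesis by (rule small_mono[rotated]) simp
qed

lemma SmI:
  assumes "hom C f X Y" "\<And>y. y \<in> el Y \<Longrightarrow> |fibre elts f y| <o \<kappa>"
  shows "f \<in> Sm"
  using assms by (auto simp: small_maps_def hom_def)

lemma SmD:
  assumes "f \<in> Sm"
  shows "f \<in> asm_maps elts app A\<^sub>s" "hom C f (src f) (trg f)"
    "y \<in> el (trg f) \<Longrightarrow> |fibre elts f y| <o \<kappa>"
  using assms by (auto simp: small_maps_def hom_def)

lemma inj_Sm:
  assumes "hom C f X Y" "inj_on (fn f) (el X)"
  shows "f \<in> Sm"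
proof (rule SmI[OF assms(1)])
  fix y assume "y \<in> el Y"
  have "finite (fibre elts f y)"
  proof (cases "fibre elts f y = {}")
    case False
    then obtain x where "x \<in> el X" "fn f x = y"
      by (auto simp: fibre_def homD(3)[OF assms(1)])
    with assms(2) have "fibre elts f y \<subseteq> {x}"
      by (auto simp: fibre_def homD(3)[OF assms(1)] inj_on_def)
    then show ?thesis using finite_subset by blast
  qed simp
  then show "|fibre elts f y| <o \<kappa>" by (rule finite_ordLess_\<kappa>)
qed

section \<open>Axioms that only concern the size of fibres\<close>

lemma A0: "A0_pullback_stability C Sm"
  unfolding A0_pullback_stability_def
proof (intro allI impI, elim conjE)
  fix p g f h assume pb: "pullback C p g f h" and f: "f \<in> Sm"
  note hs = pullback_homD[OF pb]
  show "g \<in> Sm"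
  proof (rule SmI[OF hom_arr[OF hs(1)]])
    fix b assume "b \<in> el (trg g)"
    then have b: "b \<in> el (src h)" using hs by simp
    then have "fn h b \<in> el (trg f)"
      using homD(5)[OF hom_arr[OF hs(5)]] hs by auto
    then have "|fibre elts f (fn h b)| <o \<kappa>" by (rule SmD(3)[OF f])
    then show "|fibre elts g b| <o \<kappa>"
      using card_of_ordIsoI[OF pullback_fibre[OF pb b]] ordIso_ordLess_trans by blast
  qed
qed

text \<open>A cover is surjective, so each fibre of \<open>f\<close> is in bijection with some fibre
  of its pullback.\<close>

lemma A1: "A1_descent C Sm"
  unfolding A1_descent_def
proof (intro allI impI, elim conjE)
  fix p g f e assume pb: "pullback C p g f e" and e: "cover C e" and g: "g \<in> Sm"
  note hs = pullback_homD[OF pb]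
  show "f \<in> Sm"
  proof (rule SmI[OF hom_arr[OF hs(2)]])
    fix y assume "y \<in> el (trg f)"
    then obtain b where b: "b \<in> el (src e)" "fn e b = y"
      using cover_surj[OF e] hs(4) by (metis imageE)
    then have "|fibre elts g b| <o \<kappa>"
      using SmD(3)[OF g] hs(3) by simp
    moreover have "|fibre elts g b| =o |fibre elts f y|"
      using card_of_ordIsoI[OF pullback_fibre[OF pb b(1)]] b(2) by simp
    ultimately show "|fibre elts f y| <o \<kappa>"
      using ordIso_symmetric ordIso_ordLess_trans by blast
  qed
qed

text \<open>Over a point of the first summand, disjointness excludes points coming from
  \<open>g\<close>, and injectivity of \<open>i'\<close> brings the rest back to a fibre of
  \<open>f\<close>. The summands play asymmetric roles; the proof for sums uses the lemma once in
  each order.\<close>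

lemma fibre_sum_subset:
  assumes cov: "el (src h) = fn i ` el (src f) \<union> fn j ` el (src g)"
    and hi: "\<And>x. x \<in> el (src f) \<Longrightarrow> fn h (fn i x) = fn i' (fn f x)"
    and hj: "\<And>x. x \<in> el (src g) \<Longrightarrow> fn h (fn j x) = fn j' (fn g x)"
    and f: "\<And>x. x \<in> el (src f) \<Longrightarrow> fn f x \<in> el (trg f)"
    and g: "\<And>x. x \<in> el (src g) \<Longrightarrow> fn g x \<in> el (trg g)"
    and inj: "inj_on (fn i') (el (trg f))"
    and disj: "fn i' ` el (trg f) \<inter> fn j' ` el (trg g) = {}"
    and y: "y \<in> el (trg f)"
  shows "fibre elts h (fn i' y) \<subseteq> fn i ` fibre elts f y"
proof
  fix p assume "p \<in> fibre elts h (fn i' y)"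
  then have p: "p \<in> el (src h)" "fn h p = fn i' y"
    by (auto simp: fibre_def)
  then consider x where "x \<in> el (src f)" "p = fn i x" | x where "x \<in> el (src g)" "p = fn j x"
    using cov by blast
  then show "p \<in> fn i ` fibre elts f y"
  proof cases
    case (1 x)
    then have "fn i' (fn f x) = fn i' y"
      using hi p(2) by simp
    then have "fn f x = y"
      using inj f[OF 1(1)] y by (auto dest: inj_onD)
    then show ?thesis using 1 by (auto simp: fibre_def)
  next
    case (2 x)
    then have "fn j' (fn g x) = fn i' y"
      using hj p(2) by simp
    then have "fn i' y \<in> fn i' ` el (trg f) \<inter> fn j' ` el (trg g)"
      using g[OF 2(1)] y by (metis IntI imageI)
    then show ?thesis using disj by simp
  qed
qed

lemma A2: "A2_sums C Sm"
  unfolding A2_sums_def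
proof (intro ballI)
  fix f g assume fg: "f \<in> Sm" "g \<in> Sm"
  note f = SmD(2)[OF fg(1)] and g = SmD(2)[OF fg(2)]
  obtain P i j where P: "coproduct C P i j" "hom C i (src f) P" "hom C j (src g) P"
    "el P = fn i ` el (src f) \<union> fn j ` el (src g)"
    using coproduct_exists[OF homD(1)[OF f] homD(1)[OF g]] by metis
  obtain Q i' j' where Q: "coproduct C Q i' j'" "hom C i' (trg f) Q" "hom C j' (trg g) Q"
    "inj_on (fn i') (el (trg f))" "inj_on (fn j') (el (trg g))"
    "el Q = fn i' ` el (trg f) \<union> fn j' ` el (trg g)" "fn i' ` el (trg f) \<inter> fn j' ` el (trg g) = {}"
    by (rule coproduct_exists[OF homD(2)[OF f] homD(2)[OF g]])
  have "\<exists>!h. hom C h P Q \<and> h \<cdot>\<^bsub>C\<^esub> i = i' \<cdot>\<^bsub>C\<^esub> f \<and> h \<cdot>\<^bsub>C\<^esub> j = j' \<cdot>\<^bsub>C\<^esub> g"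
    using P(1) hom_comp[OF f Q(2)] hom_comp[OF g Q(3)]
    by (simp add: coproduct_def homD(3)[OF P(2)] homD(3)[OF P(3)])
  then obtain h where h: "hom C h P Q" "h \<cdot>\<^bsub>C\<^esub> i = i' \<cdot>\<^bsub>C\<^esub> f" "h \<cdot>\<^bsub>C\<^esub> j = j' \<cdot>\<^bsub>C\<^esub> g"
    by blast
  have hi: "fn h (fn i x) = fn i' (fn f x)" if "x \<in> el (src f)" for x
    using arg_cong[OF h(2), of "\<lambda>m. fn m x"] that by (simp add: homD(3)[OF P(2)])
  have hj: "fn h (fn j x) = fn j' (fn g x)" if "x \<in> el (src g)" for x
    using arg_cong[OF h(3), of "\<lambda>m. fn m x"] that by (simp add: homD(3)[OF P(3)])
  have "h \<in> Sm"
  proof (rule SmI[OF h(1)])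
    fix z assume "z \<in> el Q"
    then consider y where "y \<in> el (trg f)" "z = fn i' y" | y where "y \<in> el (trg g)" "z = fn j' y"
      using Q(6) by blast
    then show "|fibre elts h z| <o \<kappa>"
    proof cases
      case (1 y)
      have "fibre elts h z \<subseteq> fn i ` fibre elts f y"
        unfolding 1(2)
        by (rule fibre_sum_subset[where j = j and g = g and j' = j'])
          (use P(4) Q(4,7) hi hj homD(5)[OF f] homD(5)[OF g] 1(1) homD(3)[OF h(1)] in auto)
      then show ?thesis
        using image_ordLess_\<kappa>[OF SmD(3)[OF fg(1) 1(1)]] subset_ordLess_\<kappa> by blast
    next
      case (2 y)
      have "fibre elts h z \<subseteq> fn j ` fibre elts g y"
        unfolding 2(2)
        by (rule fibre_sum_subset[where j = i and g = f and j' = i'])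
          (use P(4) Q(5,7) hi hj homD(5)[OF f] homD(5)[OF g] 2(1) homD(3)[OF h(1)] in auto)
      then show ?thesis
        using image_ordLess_\<kappa>[OF SmD(3)[OF fg(2) 2(1)]] subset_ordLess_\<kappa> by blast
    qed
  qed
  moreover have "sum_map C f g h"
    unfolding sum_map_def Asm_simps homD(3,4)[OF h(1)]
    using SmD(1)[OF fg(1)] SmD(1)[OF fg(2)] arr_hom[OF h(1)] h(2,3) P(1) Q(1)
      homD(3)[OF P(2)] homD(3)[OF P(3)] homD(3)[OF Q(2)] homD(3)[OF Q(3)] by blast
  ultimately show "\<exists>h\<in>Sm. sum_map C f g h" by blast
qed

lemma finite_Sm:
  assumes "terminal C T" "X \<in> asms" "finite (el X)"
  shows "\<exists>f\<in>Sm. hom C f X T"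
proof -
  obtain f where f: "hom C f X T"
    using assms(1,2) by (auto simp: terminal_def)
  have "finite (fibre elts f y)" for y
    using assms(3) by (simp add: fibre_def homD(3)[OF f])
  then have "f \<in> Sm"
    using SmI[OF f] finite_ordLess_\<kappa> by blast
  then show ?thesis using f by blast
qed

lemma A3: "A3_finiteness C Sm"
proof -
  obtain T t where T: "terminal C T" "el T = {t}"
    using terminal_exists by blast
  then have Tobj: "T \<in> asms" by (simp add: terminal_def)
  obtain Z where Z: "initial C Z" "el Z = {}"
    using initial_exists by blast
  then have Zobj: "Z \<in> asms" by (simp add: initial_def)
  obtain P i j where P: "coproduct C P i j" "hom C i T P" "hom C j T P" "el P = fn i ` el T \<union> fn j ` el T"
    using coproduct_exists[OF Tobj Tobj] by metis
  have "\<exists>f\<in>Sm. hom C f Z T" "\<exists>f\<in>Sm. hom C f T T" "\<exists>f\<in>Sm. hom C f P T"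
    using Z(2) P(4) T(2) homD(2)[OF P(2)] by (auto intro!: finite_Sm T(1) Tobj Zobj)
  then show ?thesis
    unfolding A3_finiteness_def Asm_simps
    using T(1) Z(1) P(1) homD(3)[OF P(2)] homD(3)[OF P(3)] by blast
qed

text \<open>The fibre of the composite is the union of the fibres of \<open>f\<close> over a fibre
  of \<open>g\<close>; regularity of \<kappa> bounds it.\<close>

lemma A4: "A4_composition C Sm"
  unfolding A4_composition_def
proof (intro ballI impI)
  fix f g assume f: "f \<in> Sm" and g: "g \<in> Sm" and "Cod C f = Dom C g"
  then have fg: "trg f = src g" by simp
  have hf: "hom C f (src f) (src g)" using SmD(2)[OF f] fg by simp
  note hg = SmD(2)[OF g]
  show "g \<cdot>\<^bsub>C\<^esub> f \<in> Sm"
  proof (rule SmI[OF hom_comp[OF hf hg]])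
    fix z assume z: "z \<in> el (trg g)"
    have "fibre elts (g \<cdot>\<^bsub>C\<^esub> f) z = (\<Union>y\<in>fibre elts g z. fibre elts f y)"
      using homD(5)[OF hf] by (auto simp: fibre_def)
    moreover have "|\<Union>y\<in>fibre elts g z. fibre elts f y| <o \<kappa>"
      using SmD(3)[OF g z] SmD(3)[OF f] fg by (intro UN_ordLess_\<kappa>) (auto simp: fibre_def)
    ultimately show "|fibre elts (g \<cdot>\<^bsub>C\<^esub> f) z| <o \<kappa>" by simp
  qed
qed

lemma A5: "A5_quotient C Sm"
  unfolding A5_quotient_def
proof (intro allI impI, elim conjE)
  fix f e
  assume "f \<in> Arr C" and e: "cover C e" and "Cod C e = Dom C f" and fe: "f \<cdot>\<^bsub>C\<^esub> e \<in> Sm"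
  then have f: "hom C f (src f) (trg f)" and ef: "trg e = src f" by (simp_all add: hom_arr)
  show "f \<in> Sm"
  proof (rule SmI[OF f])
    fix z assume z: "z \<in> el (trg f)"
    have "fibre elts f z \<subseteq> fn e ` fibre elts (f \<cdot>\<^bsub>C\<^esub> e) z"
    proof
      fix y assume y: "y \<in> fibre elts f z"
      then obtain x where "x \<in> el (src e)" "y = fn e x"
        using cover_surj[OF e] ef by (auto simp: fibre_def)
      then show "y \<in> fn e ` fibre elts (f \<cdot>\<^bsub>C\<^esub> e) z"
        using y by (auto simp: fibre_def)
    qed
    moreover have "|fibre elts (f \<cdot>\<^bsub>C\<^esub> e) z| <o \<kappa>"
      using SmD(3)[OF fe] z by simp
    ultimately show "|fibre elts f z| <o \<kappa>"
      using image_ordLess_\<kappa> subset_ordLess_\<kappa> by blast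
  qed
qed

text \<open>The cover \<open>p\<close> is refined over its own base: a realizer \<open>r\<close> of \<open>p\<close> being a cover sends
  each realizer \<open>a\<close> of \<open>x\<close> to a realizer of some point over \<open>x\<close>, so \<open>p\<close> has a section over the
  assembly of pairs \<open>(x, a)\<close>, whose fibres over \<open>X\<close> are bounded by the size of the pca.\<close>

lemma A6: "A6_collection C Sm"
  unfolding A6_collection_def
proof (intro allI impI, elim conjE)
  fix Y X A p f
  assume cp: "cover C p" and p: "hom C p Y X" and fS: "f \<in> Sm" and f: "hom C f X A"
  note Xo = homD(1)[OF f] and Yo = homD(1)[OF p]
  note srcp = homD(3)[OF p] and trgp = homD(4)[OF p]
  obtain r where r: "r \<in> A\<^sub>s" "\<And>x. x \<in> el X \<Longrightarrow> trk app r (exist X x) (image_exist p x)"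
    using cover_trk[OF cp] unfolding trgp by blast
  let ?S = "SIGMA x:el X. fst (exist X x)"
  \<comment> \<open>The pair has \<open>a\<close> as its only realizer, and this counts as one of
    the second kind exactly when it does so for \<open>x\<close>.\<close>
  let ?E = "\<lambda>(x, a). ({a}, {a} \<inter> snd (exist X x))"
  have "small ?S"
    by (rule small_mono[OF _ small_Times[OF elts_small small_pca[of UNIV]]]) auto
  then obtain Z \<phi> \<psi> where Z: "realizes ?S ?E Z \<phi> \<psi>"
    by (rule realizes_exists[of ?S ?E]) (use asm_snd(1)[OF Xo] in \<open>auto simp: Sigma_pca_def subset_iff\<close>)
  note Zr = realizesD[OF Z]
  \<comment> \<open>One preimage must suit both components. If \<open>a\<close> is of the second
    kind, take the preimage given by the second component of the cover's realizer: its realizer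
    there is also one of the first kind. Otherwise the second component is empty and the first one
    decides.\<close>
  have "\<exists>y. y \<in> el Y \<and> fn p y = x \<and> trk app r ({a}, {a} \<inter> snd (exist X x)) (exist Y y)"
    if x: "x \<in> el X" "a \<in> fst (exist X x)" for x a
  proof (cases "a \<in> snd (exist X x)")
    case True
    then obtain b y where "y \<in> el Y" "fn p y = x" "b \<in> snd (exist Y y)" "app r a = Some b"
      using trkD(2)[OF r(2)[OF x(1)] True] by (auto simp: image_exist_def fibre_def srcp)
    then show ?thesis
      using subsetD[OF asm_snd(2)[OF Yo]] by (intro exI[of _ y]) (auto intro!: trkI)
  next
    case False
    then obtain b y where "y \<in> el Y" "fn p y = x" "b \<in> fst (exist Y y)" "app r a = Some b"
      using trkD(1)[OF r(2)[OF x(1)] x(2)] by (auto simp: image_exist_def fibre_def srcp)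
    then show ?thesis
      using False by (intro exI[of _ y]) (auto intro!: trkI)
  qed
  then obtain y where y: "\<And>x a. x \<in> el X \<Longrightarrow> a \<in> fst (exist X x) \<Longrightarrow> y x a \<in> el Y \<and> fn p (y x a) = x \<and>
      trk app r ({a}, {a} \<inter> snd (exist X x)) (exist Y (y x a))"
    by metis
  have dec: "\<exists>x a. \<psi> v = (x, a) \<and> x \<in> el X \<and> a \<in> fst (exist X x) \<and>
      exist Z v = ({a}, {a} \<inter> snd (exist X x))" if "v \<in> el Z" for v
    using Zr(5)[OF that] Zr(7)[OF that] by (cases "\<psi> v") auto
  define q where "q = mk Z Y (\<lambda>v. case_prod y (\<psi> v))"
  have q: "hom C q Z Y"
    unfolding q_def by (rule mk_hom[OF Zr(1) Yo _ r(1)]) (use dec y in fastforce)+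
  note pq = hom_comp[OF q p]
  have fnpq: "fn (p \<cdot>\<^bsub>C\<^esub> q) v = fst (\<psi> v)" if "v \<in> el Z" for v
    using dec[OF that] that y by (auto simp: q_def)
  have fibre_pq: "fibre elts (p \<cdot>\<^bsub>C\<^esub> q) x = (\<lambda>a. \<phi> (x, a)) ` fst (exist X x)" if "x \<in> el X" for x
  proof (intro equalityI subsetI)
    fix v assume "v \<in> fibre elts (p \<cdot>\<^bsub>C\<^esub> q) x"
    then have v: "v \<in> el Z" "fst (\<psi> v) = x"
      using fnpq by (auto simp: fibre_def homD(3)[OF q])
    then obtain a where "\<psi> v = (x, a)" "a \<in> fst (exist X x)"
      using dec by force
    then show "v \<in> (\<lambda>a. \<phi> (x, a)) ` fst (exist X x)"
      using Zr(6)[OF v(1)] by (metis imageI)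
  next
    fix v assume "v \<in> (\<lambda>a. \<phi> (x, a)) ` fst (exist X x)"
    then obtain a where a: "v = \<phi> (x, a)" "(x, a) \<in> ?S"
      using \<open>x \<in> el X\<close> by auto
    then show "v \<in> fibre elts (p \<cdot>\<^bsub>C\<^esub> q) x"
      using fnpq[OF Zr(2)[OF a(2)]] Zr(2)[OF a(2)] Zr(3)[OF a(2)]
      by (simp add: fibre_def homD(3)[OF q])
  qed
  have cpq: "cover C (p \<cdot>\<^bsub>C\<^esub> q)"
  proof (rule coverI[OF pq _ cI_mem])
    show "fn (p \<cdot>\<^bsub>C\<^esub> q) ` el Z = el X"
    proof (intro equalityI subsetI)
      show "x \<in> el X" if "x \<in> fn (p \<cdot>\<^bsub>C\<^esub> q) ` el Z" for x
        using that homD(5)[OF pq] by blast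
      show "x \<in> fn (p \<cdot>\<^bsub>C\<^esub> q) ` el Z" if x: "x \<in> el X" for x
      proof -
        have "fibre elts (p \<cdot>\<^bsub>C\<^esub> q) x \<noteq> {}"
          using fibre_pq[OF x] asmD(2)[OF Xo x] by simp
        then show ?thesis by (auto simp: fibre_def homD(3)[OF q])
      qed
    qed
    \<comment> \<open>The fibre over \<open>x\<close> runs through all realizers of
      \<open>x\<close>, so the union of its singletons restores both components of
      \<open>exist X x\<close> and the identity combinator suffices.\<close>
    show "trk app cI (exist X x) (image_exist (p \<cdot>\<^bsub>C\<^esub> q) x)" if x: "x \<in> el X" for x
    proof -
      have ex: "exist Z (\<phi> (x, a)) = ({a}, {a} \<inter> snd (exist X x))" if "a \<in> fst (exist X x)" for a
        using Zr(4)[of "(x, a)"] x that by simp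
      have "fst (image_exist (p \<cdot>\<^bsub>C\<^esub> q) x) = fst (exist X x)"
        by (simp add: image_exist_def fibre_pq[OF x] homD(3)[OF q] ex)
      moreover have "snd (image_exist (p \<cdot>\<^bsub>C\<^esub> q) x) = snd (exist X x)"
        using asm_snd(2)[OF Xo x] by (auto simp: image_exist_def fibre_pq[OF x] homD(3)[OF q] ex)
      ultimately show ?thesis
        by (auto intro: trkI)
    qed
  qed
  have pqS: "p \<cdot>\<^bsub>C\<^esub> q \<in> Sm"
  proof (rule SmI[OF pq])
    fix x assume x: "x \<in> el X"
    have "|fst (exist X x)| <o \<kappa>"
      by (rule subset_ordLess_\<kappa>[OF subset_UNIV card_pca])
    then show "|fibre elts (p \<cdot>\<^bsub>C\<^esub> q) x| <o \<kappa>"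
      unfolding fibre_pq[OF x] by (rule image_ordLess_\<kappa>)
  qed
  \<comment> \<open>The small map required by the axiom is this composite, with the identity of
    \<open>A\<close> as the cover \<open>h\<close>.\<close>
  have "f \<cdot>\<^bsub>C\<^esub> (p \<cdot>\<^bsub>C\<^esub> q) \<in> Sm"
    using A4 fS pqS homD(3)[OF f] homD(4)[OF p] by (simp add: A4_composition_def)
  moreover note hom_comp[OF pq f] cover_idm[OF homD(2)[OF f]] idm_hom[OF homD(2)[OF f]]
    quasi_pullback_idm[OF f cpq pq] q
  ultimately show "\<exists>B Z h g q. cover C h \<and> hom C h B A \<and> g \<in> Sm \<and> hom C g Z B \<and> hom C q Z Y \<and>
      quasi_pullback C (p \<cdot>\<^bsub>C\<^esub> q) g f h"
    by blast
qed

text \<open>A family of assemblies with carriers inside \<open>elts c\<close> is coded as a set of triples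
  \<open>(d, a, b)\<close>: \<open>a\<close> is a realizer of \<open>d\<close> of the first or second kind according to \<open>b\<close>. The
  object \<open>U\<close> of codes has trivial realizers, so that any function into it is a map; every
  small map is then itself a pullback of \<open>\<pi>\<close>.\<close>

definition slice :: "('v \<times> 'a \<times> bool) set \<Rightarrow> 'v \<Rightarrow> 'a set \<times> 'a set" where
  "slice R d = ({a. (d, a, True) \<in> R}, {a. (d, a, False) \<in> R})"

text \<open>Points of an assembly have a nonempty first component, so the carrier of a coded
  assembly can be read off from the triples.\<close>

definition support :: "('v \<times> 'a \<times> bool) set \<Rightarrow> 'v set" where
  "support R = {d. fst (slice R d) \<noteq> {}}"

lemma A7: "A7_representability C Sm"
proof -
  obtain c where c: "\<kappa> =o |elts c|"
    using \<kappa>_in_universe by blast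
  \<comment> \<open>The bound on \<open>support\<close> is what makes \<open>\<pi>\<close> small:
    its fibre over a code is indexed by the support of that code.\<close>
  define SU where "SU = {R. R \<subseteq> elts c \<times> UNIV \<and> (\<forall>d. slice R d \<in> Sigma_pca A\<^sub>s) \<and> |support R| <o \<kappa>}"
  have "small (Pow (elts c \<times> (UNIV :: ('a \<times> bool) set)))"
    unfolding UNIV_Times_UNIV[symmetric]
    by (intro small_Pow small_Times elts_small small_pca small_finite) simp
  then have smU: "small SU"
    by (rule small_mono[rotated]) (auto simp: SU_def)
  then obtain U \<phi> \<psi> where U: "realizes SU (\<lambda>_. (UNIV, A\<^sub>s)) U \<phi> \<psi>"
    by (rule realizes_exists[of SU "\<lambda>_. (UNIV, A\<^sub>s)"]) (simp_all add: top_mem)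
  let ?SE = "SIGMA R:SU. support R"
  have "?SE \<subseteq> SU \<times> elts c"
    by (auto simp: SU_def support_def slice_def)
  then have "small ?SE"
    using small_mono small_Times[OF smU elts_small] by blast
  then obtain E \<phi>' \<psi>' where E: "realizes ?SE (\<lambda>(R, d). slice R d) E \<phi>' \<psi>'"
    by (rule realizes_exists[of ?SE "\<lambda>(R, d). slice R d"]) (auto simp: SU_def support_def)
  note Ur = realizesD[OF U] and Er = realizesD[OF E]
  define \<pi> where "\<pi> = mk E U (\<lambda>e. \<phi> (fst (\<psi>' e)))"
  have \<psi>'_mem: "fst (\<psi>' e) \<in> SU" "snd (\<psi>' e) \<in> support (fst (\<psi>' e))" if "e \<in> el E" for e
    using Er(5)[OF that] by (cases "\<psi>' e"; simp)+
  have \<pi>: "hom C \<pi> E U"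
    unfolding \<pi>_def
  proof (rule mk_hom[OF Er(1) Ur(1) _ cI_mem])
    fix e assume e: "e \<in> el E"
    show "\<phi> (fst (\<psi>' e)) \<in> el U"
      by (rule Ur(2)[OF \<psi>'_mem(1)[OF e]])
    show "trk app cI (exist E e) (exist U (\<phi> (fst (\<psi>' e))))"
      unfolding Ur(4)[OF \<psi>'_mem(1)[OF e]] by (rule trk_top[OF asmD(1)[OF Er(1) e]])
  qed
  have "\<pi> \<in> Sm"
  proof (rule SmI[OF \<pi>])
    fix v assume v: "v \<in> el U"
    have "fibre elts \<pi> v \<subseteq> (\<lambda>d. \<phi>' (\<psi> v, d)) ` support (\<psi> v)"
    proof
      fix e assume "e \<in> fibre elts \<pi> v"
      then have e: "e \<in> el E" "\<phi> (fst (\<psi>' e)) = v"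
        by (auto simp: fibre_def \<pi>_def)
      then have "fst (\<psi>' e) = \<psi> v"
        using Ur(3)[OF \<psi>'_mem(1)[OF e(1)]] by simp
      then have "e = \<phi>' (\<psi> v, snd (\<psi>' e))" "snd (\<psi>' e) \<in> support (\<psi> v)"
        using Er(6)[OF e(1)] \<psi>'_mem(2)[OF e(1)] by (metis prod.collapse, simp)
      then show "e \<in> (\<lambda>d. \<phi>' (\<psi> v, d)) ` support (\<psi> v)" by (rule image_eqI)
    qed
    moreover have "|support (\<psi> v)| <o \<kappa>"
      using Ur(5)[OF v] by (simp add: SU_def)
    ultimately show "|fibre elts \<pi> v| <o \<kappa>"
      using image_ordLess_\<kappa> subset_ordLess_\<kappa> by blast
  qed
  moreover have "\<exists>f' r u y x. pullback C r f' \<pi> u \<and> cover C y \<and> cover C x \<and> quasi_pullback C y f' f x"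
    if fS: "f \<in> Sm" for f
  proof -
    define X Y where "X = trg f" and "Y = src f"
    have f: "hom C f Y X"
      using SmD(2)[OF fS] by (simp add: X_def Y_def)
    note Yo = homD(1)[OF f] and Xo = homD(2)[OF f]
    have mem_fibre: "y \<in> fibre elts f x \<longleftrightarrow> y \<in> el Y \<and> fn f y = x" for x y
      by (simp add: fibre_def Y_def)
    have "\<exists>j. inj_on j (fibre elts f x) \<and> j ` fibre elts f x \<subseteq> elts c" if "x \<in> el X" for x
    proof -
      have "|fibre elts f x| \<le>o |elts c|"
        using SmD(3)[OF fS] that c ordLess_imp_ordLeq ordLeq_ordIso_trans unfolding X_def by blast
      then show ?thesis by (simp add: card_of_ordLeq)
    qed
    \<comment> \<open>The injections for different \<open>x\<close> are chosen independently and
      without any realizer; they enter only the codes, whose realizers are trivial.\<close>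
    then obtain j where j: "\<And>x. x \<in> el X \<Longrightarrow> inj_on (j x) (fibre elts f x)"
      "\<And>x. x \<in> el X \<Longrightarrow> j x ` fibre elts f x \<subseteq> elts c"
      by metis
    \<comment> \<open>The code of the fibre over \<open>x\<close>, with the realizers of
      \<open>Y\<close> transported along \<open>j x\<close>. Since \<open>j x\<close> is injective
      there, \<open>slice\<close> recovers them exactly.\<close>
    define R where "R x = {(d, a, b). \<exists>y\<in>fibre elts f x. d = j x y \<and>
      a \<in> (if b then fst (exist Y y) else snd (exist Y y))}" for x
    have slice: "slice (R x) (j x y) = exist Y y" if "x \<in> el X" "y \<in> fibre elts f x" for x y
      using that inj_onD[OF j(1)] by (auto simp: slice_def R_def prod_eq_iff)
    have slice': "slice (R x) d = ({}, {})" if "d \<notin> j x ` fibre elts f x" for x d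
      using that by (auto simp: slice_def R_def)
    have support: "support (R x) = j x ` fibre elts f x" if x: "x \<in> el X" for x
    proof (intro equalityI subsetI)
      show "d \<in> j x ` fibre elts f x" if "d \<in> support (R x)" for d
        using that slice'[of d x] by (auto simp: support_def)
      show "d \<in> support (R x)" if "d \<in> j x ` fibre elts f x" for d
        using that slice[OF x] asmD(2)[OF Yo] by (auto simp: support_def mem_fibre)
    qed
    have R: "R x \<in> SU" if x: "x \<in> el X" for x
      unfolding SU_def
    proof (intro CollectI conjI allI)
      show "R x \<subseteq> elts c \<times> UNIV"
        using j(2)[OF x] by (auto simp: R_def)
      show "slice (R x) d \<in> Sigma_pca A\<^sub>s" for d
      proof (cases "d \<in> j x ` fibre elts f x")
        case True
        then obtain y where "y \<in> fibre elts f x" "d = j x y" by blast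
        then show ?thesis
          using slice[OF x] asmD(1)[OF Yo, of y] by (simp add: mem_fibre)
      qed (simp add: slice' Sigma_pca_def)
      show "|support (R x)| <o \<kappa>"
        unfolding support[OF x] using SmD(3)[OF fS] x by (intro image_ordLess_\<kappa>) (simp add: X_def)
    qed
    have RE: "(R (fn f y), j (fn f y) y) \<in> ?SE" if "y \<in> el Y" for y
    proof (rule SigmaI)
      have x: "fn f y \<in> el X" using homD(5)[OF f that] .
      show "R (fn f y) \<in> SU" by (rule R[OF x])
      show "j (fn f y) y \<in> support (R (fn f y))"
        unfolding support[OF x] using that by (simp add: mem_fibre)
    qed
    define u where "u = mk X U (\<lambda>x. \<phi> (R x))"
    define r where "r = mk Y E (\<lambda>y. \<phi>' (R (fn f y), j (fn f y) y))"
    have u: "hom C u X U"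
      unfolding u_def
    proof (rule mk_hom[OF Xo Ur(1) _ cI_mem])
      fix x assume x: "x \<in> el X"
      show "\<phi> (R x) \<in> el U" by (rule Ur(2)[OF R[OF x]])
      show "trk app cI (exist X x) (exist U (\<phi> (R x)))"
        unfolding Ur(4)[OF R[OF x]] by (rule trk_top[OF asmD(1)[OF Xo x]])
    qed
    have exr: "exist E (\<phi>' (R (fn f y), j (fn f y) y)) = exist Y y" if "y \<in> el Y" for y
      using Er(4)[OF RE[OF that]] slice[OF homD(5)[OF f that], of y] that by (simp add: mem_fibre)
    have r: "hom C r Y E"
      unfolding r_def
    proof (rule mk_hom[OF Yo Er(1) _ cI_mem])
      fix y assume y: "y \<in> el Y"
      show "\<phi>' (R (fn f y), j (fn f y) y) \<in> el E" by (rule Er(2)[OF RE[OF y]])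
      show "trk app cI (exist Y y) (exist E (\<phi>' (R (fn f y), j (fn f y) y)))"
        unfolding exr[OF y] by (rule trk_id)
    qed
    have fnr: "fn r y = \<phi>' (R (fn f y), j (fn f y) y)" if "y \<in> el Y" for y
      using that by (simp add: r_def)
    \<comment> \<open>The image under \<open>r\<close> still contains \<open>j (fn f y) y\<close>,
      which determines \<open>y\<close> within its fibre. Uniqueness of mediating arrows follows
      from this.\<close>
    have joint_inj: "y = y'"
      if y: "y \<in> el Y" "y' \<in> el Y" "fn r y = fn r y'" "fn f y = fn f y'" for y y'
    proof -
      have "\<psi>' (fn r y) = (R (fn f y), j (fn f y) y)" "\<psi>' (fn r y') = (R (fn f y'), j (fn f y') y')"
        using Er(3)[OF RE[OF y(1)]] Er(3)[OF RE[OF y(2)]]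
        unfolding fnr[OF y(1)] fnr[OF y(2)] .
      then have "j (fn f y) y = j (fn f y) y'"
        unfolding y(3) y(4) by (metis snd_conv)
      moreover have "y \<in> fibre elts f (fn f y)" "y' \<in> fibre elts f (fn f y)"
        using y by (simp_all add: mem_fibre)
      ultimately show ?thesis
        by (rule inj_onD[OF j(1)[OF homD(5)[OF f y(1)]]])
    qed
    have "pullback C r f \<pi> u"
      unfolding pullback_def
    proof (intro conjI allI impI)
      have "\<pi> \<cdot>\<^bsub>C\<^esub> r = u \<cdot>\<^bsub>C\<^esub> f"
      proof (rule hom_eqI[OF hom_comp[OF r \<pi>] hom_comp[OF f u]])
        fix y assume y: "y \<in> el Y"
        show "fn (\<pi> \<cdot>\<^bsub>C\<^esub> r) y = fn (u \<cdot>\<^bsub>C\<^esub> f) y"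
          using y Er(2)[OF RE[OF y]] Er(3)[OF RE[OF y]] homD(5)[OF f y]
          by (simp add: homD(3)[OF r] homD(3)[OF f] fnr \<pi>_def u_def)
      qed
      then show "commutes C r f \<pi> u"
        unfolding commutes_def using r f \<pi> u by blast
      fix p q assume "commutes C p q \<pi> u"
      then obtain W where p: "hom C p W E" and q: "hom C q W X" and pq: "\<pi> \<cdot>\<^bsub>C\<^esub> p = u \<cdot>\<^bsub>C\<^esub> q"
        using \<pi> u by (auto simp: commutes_def hom_def)
      \<comment> \<open>Commutativity says that the code underlying \<open>fn p w\<close> is
        \<open>R (fn q w)\<close>. Its remaining coordinate lies in the support of that code and so
        comes from a point of the fibre of \<open>f\<close> over \<open>fn q w\<close>.\<close>
      have "\<exists>y. y \<in> el Y \<and> fn f y = fn q w \<and> fn r y = fn p w" if w: "w \<in> el W" for w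
      proof -
        have e: "fn p w \<in> el E" and x: "fn q w \<in> el X"
          using homD(5)[OF p w] homD(5)[OF q w] .
        have "\<phi> (fst (\<psi>' (fn p w))) = \<phi> (R (fn q w))"
          using arg_cong[OF pq, of "\<lambda>m. fn m w"] w e x
          by (simp add: homD(3)[OF p] homD(3)[OF q] \<pi>_def u_def)
        then have *: "fst (\<psi>' (fn p w)) = R (fn q w)"
          using Ur(3)[OF \<psi>'_mem(1)[OF e]] Ur(3)[OF R[OF x]] by argo
        then obtain y where y: "y \<in> fibre elts f (fn q w)" "snd (\<psi>' (fn p w)) = j (fn q w) y"
          using \<psi>'_mem(2)[OF e] support[OF x] by auto
        have "\<psi>' (fn p w) = (R (fn q w), j (fn q w) y)"
          using * y(2) by (simp add: prod_eq_iff)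
        then have "fn p w = \<phi>' (R (fn q w), j (fn q w) y)"
          using Er(6)[OF e] by simp
        then show ?thesis
          using y(1) by (auto simp: mem_fibre fnr)
      qed
      then obtain m where m: "\<And>w. w \<in> el W \<Longrightarrow> m w \<in> el Y"
        "\<And>w. w \<in> el W \<Longrightarrow> fn f (m w) = fn q w" "\<And>w. w \<in> el W \<Longrightarrow> fn r (m w) = fn p w"
        by metis
      obtain t where t: "t \<in> A\<^sub>s" "\<And>w. w \<in> el W \<Longrightarrow> trk app t (exist W w) (exist E (fn p w))"
        using homD(6)[OF p] by blast
      \<comment> \<open>The points \<open>fn p w\<close> and \<open>m w\<close> have the same
        realizers, so a realizer of \<open>p\<close> also realizes the mediating arrow.\<close>
      have exm: "exist E (fn p w) = exist Y (m w)" if "w \<in> el W" for w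
        using exr[OF m(1)[OF that]] m(3)[OF that] fnr[OF m(1)[OF that]] by simp
      have mh: "hom C (mk W Y m) W Y"
        by (rule mk_hom[OF homD(1)[OF p] Yo m(1) t(1)]) (use t(2) exm in simp_all)
      have "r \<cdot>\<^bsub>C\<^esub> mk W Y m = p"
        by (rule hom_eqI[OF hom_comp[OF mh r] p]) (simp add: m)
      moreover have "f \<cdot>\<^bsub>C\<^esub> mk W Y m = q"
        by (rule hom_eqI[OF hom_comp[OF mh f] q]) (simp add: m)
      moreover have "n = n'" if n: "hom C n W Y" "r \<cdot>\<^bsub>C\<^esub> n = p" "f \<cdot>\<^bsub>C\<^esub> n = q"
        and n': "hom C n' W Y" "r \<cdot>\<^bsub>C\<^esub> n' = p" "f \<cdot>\<^bsub>C\<^esub> n' = q" for n n'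
      proof (rule hom_eqI[OF n(1) n'(1)], rule joint_inj)
        fix w assume w: "w \<in> el W"
        show "fn n w \<in> el Y" "fn n' w \<in> el Y"
          using homD(5)[OF n(1) w] homD(5)[OF n'(1) w] .
        have "fn (r \<cdot>\<^bsub>C\<^esub> n) w = fn (r \<cdot>\<^bsub>C\<^esub> n') w" "fn (f \<cdot>\<^bsub>C\<^esub> n) w = fn (f \<cdot>\<^bsub>C\<^esub> n') w"
          by (simp_all only: n(2,3) n'(2,3))
        then show "fn r (fn n w) = fn r (fn n' w)" "fn f (fn n w) = fn f (fn n' w)"
          using w by (simp_all add: homD(3)[OF n(1)] homD(3)[OF n'(1)])
      qed
      ultimately show "\<exists>!m. hom C m (Dom C p) (Dom C r) \<and> r \<cdot>\<^bsub>C\<^esub> m = p \<and> f \<cdot>\<^bsub>C\<^esub> m = q"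
        unfolding Asm_simps homD(3)[OF p] homD(3)[OF r] using mh by blast
    qed
    moreover have "quasi_pullback C (idm Y) f f (idm X)"
      using quasi_pullback_idm[OF f cover_idm[OF Yo] idm_hom[OF Yo]] comp_idm[OF f] by simp
    ultimately show ?thesis
      using cover_idm[OF Yo] cover_idm[OF Xo] by blast
  qed
  ultimately show ?thesis
    unfolding A7_representability_def by blast
qed

text \<open>Fibres of the map from \<open>N\<close> are subsets of a countable carrier, and \<kappa>
  is uncountable.\<close>

lemma A8: "A8_infinity C Sm"
proof -
  obtain T N where N: "natural_numbers_object C T N" "|el N| \<le>o |UNIV :: nat set|"
    using nno_exists by blast
  then obtain z where z: "terminal C T" "hom C z T N"
    by (auto simp: natural_numbers_object_def)
  obtain f where f: "hom C f N T"
    using z homD(2)[OF z(2)] by (auto simp: terminal_def)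
  have "f \<in> Sm"
  proof (rule SmI[OF f])
    fix y
    have "|fibre elts f y| \<le>o |UNIV :: nat set|"
      using N(2) card_of_mono1[of "fibre elts f y" "el N"] ordLeq_transitive
      by (auto simp: fibre_def homD(3)[OF f])
    moreover have "|UNIV :: nat set| <o \<kappa>"
      using card_of_nat inaccessible ordIso_ordLess_trans by (auto simp: strongly_inaccessible_def)
    ultimately show "|fibre elts f y| <o \<kappa>"
      by (rule ordLeq_ordLess_trans)
  qed
  then show ?thesis
    unfolding A8_infinity_def using N(1) f by blast
qed

lemma A9: "A9_separation C Sm"
  unfolding A9_separation_def
proof (intro allI impI)
  fix f assume f: "monic C f"
  then have "f \<in> asm_maps elts app A\<^sub>s" by (simp add: monic_def)
  then show "f \<in> Sm"
    using inj_Sm[OF hom_arr monic_inj[OF f]] by simp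
qed

theorem small_maps_class: "class_of_small_maps C Sm"
  unfolding class_of_small_maps_def
  by (intro conjI A0 A1 A2 A3 A4 A5 A6 A7 A8 A9) (auto simp: SmD(1))

end

theorem theorem3p1:
  fixes elts :: "'v \<Rightarrow> 'v set"
    and app :: "'a \<Rightarrow> 'a \<Rightarrow> 'a option"
    and A\<^sub>s :: "'a set"
    and \<kappa> :: "'k rel"
  assumes "zfc_universe elts"
    and "pca app"
    and "sub_pca app A\<^sub>s"
    and "strongly_inaccessible \<kappa>"
    and "\<exists>c. \<kappa> =o |elts c|"
    and "|UNIV :: 'a set| <o \<kappa>"
  shows "class_of_small_maps (Asm elts app A\<^sub>s) (small_maps elts app A\<^sub>s \<kappa>)"
proof -
  \<comment> \<open>The combinators are taken from the sub-pca, so that the programs built from them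
    are realizers in \<open>A\<^sub>s\<close>.\<close>
  obtain k s where "k \<in> A\<^sub>s" "s \<in> A\<^sub>s"
    and "\<And>x y z. pap app (app k x) (Some y) = Some x \<and> pap app (app s x) (Some y) \<noteq> None \<and>
      pap app (pap app (app s x) (Some y)) (Some z) = pap app (app x z) (app y z)"
    using assms(3) unfolding sub_pca_def by blast
  moreover have "\<And>x y z. x \<in> A\<^sub>s \<Longrightarrow> y \<in> A\<^sub>s \<Longrightarrow> app x y = Some z \<Longrightarrow> z \<in> A\<^sub>s"
    using assms(3) unfolding sub_pca_def by blast
  ultimately interpret small_assembly_maps app A\<^sub>s k s elts \<kappa>
    using assms(1,4-6) by unfold_locales blast+
  show ?thesis by (rule small_maps_class)
qed

end
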